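(* Let $D$ be a digraph. If $\Delta^+(D)\le 4$ or $\Delta(U(D))\le 6$ or $\Delta(D)\le 7$, then $D$ is majority $3$-choosable.
   Context: Digraphs are finite, loopless, have no parallel edges, but may have anti-parallel pairs of edges (digons). $N^+(v)$ denotes the set of out-neighbors of $v$; $d^+(v)$ and $d^-(v)$ are the out- and in-degree of $v$. $\Delta^+(D)=\max_v d^+(v)$ is the maximum out-degree, and $\Delta(D)=\max\{d^+(v)+d^-(v) : v\in V(D)\}$. The underlying graph $U(D)$ is the simple undirected graph on $V(D)$ in which $x\ne y$ are adjacent iff $(x,y)\in E(D)$ or $(y,x)\in E(D)$; $\Delta(U(D))$ is its maximum degree. A majority coloring of $D$ is a vertex-coloring $c$ such that for every $v\in V(D)$, at most half of the out-neighbors $w\in N^+(v)$ satisfy $c(w)=c(v)$. $D$ is majority $k$-choosable if for every assignment of lists $L(v)$ of colors with $|L(v)|\ge k$ to the vertices $v\in V(D)$, there is a majority coloring $c$ of $D$ with $c(v)\in L(v)$ for all $v\in V(D)$. *)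

theory Defs
  imports "Graph_Theory.Digraph_Component"
begin

text \<open>
  The maxima below are taken over \<open>insert 0\<close>, so that they are 0 for the null digraph; for every
  other finite digraph this is the maximum over the vertices.
\<close>

definition max_out_degree :: "('a, 'b) pre_digraph \<Rightarrow> nat" where
  "max_out_degree D = Max (insert 0 (out_degree D ` verts D))"

definition max_degree :: "('a, 'b) pre_digraph \<Rightarrow> nat" where
  "max_degree D = Max (insert 0 ((\<lambda>v. out_degree D v + in_degree D v) ` verts D))"

text \<open>
  The underlying graph is \<^const>\<open>mk_symmetric\<close>: in Graph-Theory, undirected graphs are symmetric
  digraphs. There an edge \<open>{x, y}\<close> is represented by the two arcs \<open>(x, y)\<close> and
  \<open>(y, x)\<close> (once each, even if \<open>D\<close> has both), so the degree of a vertex in the undirected graph is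
  its out-degree in \<^const>\<open>mk_symmetric\<close>, not the sum of its out-degree and its in-degree.
\<close>

definition max_degree_underlying :: "('a, 'b) pre_digraph \<Rightarrow> nat" where
  "max_degree_underlying D = max_out_degree (with_proj (mk_symmetric D))"

definition out_neighbors :: "('a, 'b) pre_digraph \<Rightarrow> 'a \<Rightarrow> 'a set" where
  "out_neighbors D v = {w. v \<rightarrow>\<^bsub>D\<^esub> w}"

definition majority_coloring :: "('a, 'b) pre_digraph \<Rightarrow> ('a \<Rightarrow> 'c) \<Rightarrow> bool" where
  "majority_coloring D c \<longleftrightarrow>
     (\<forall>v\<in>verts D. 2 * card {w \<in> out_neighbors D v. c w = c v} \<le> card (out_neighbors D v))"

text \<open>
  The type of colors is a parameter. Lists may be infinite; the cardinality \<^const>\<open>card\<close> of an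
  infinite set is 0, so the bound on the size is imposed on finite lists only.
\<close>

definition majority_choosable :: "'c itself \<Rightarrow> nat \<Rightarrow> ('a, 'b) pre_digraph \<Rightarrow> bool" where
  "majority_choosable (_ :: 'c itself) k D \<longleftrightarrow>
     (\<forall>L :: 'a \<Rightarrow> 'c set. (\<forall>v\<in>verts D. finite (L v) \<longrightarrow> k \<le> card (L v)) \<longrightarrow>
        (\<exists>c. majority_coloring D c \<and> (\<forall>v\<in>verts D. c v \<in> L v)))"

end

theory Submission
  imports Defs
begin

text \<open>
  The lists may be cut down to three colors. Choose for every vertex \<open>v\<close> a pair \<open>q v\<close> of colors from
  its list and allow only these two colors at \<open>v\<close>. If \<open>q w \<noteq> q v\<close>, then an out-neighbor \<open>w\<close> of \<open>v\<close>
  can take at most one of the two colors of \<open>v\<close>, whatever \<open>w\<close> does later. So such a \<open>w\<close> can be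
  charged in advance to at most one option of \<open>v\<close>, and only the arcs inside a class of vertices with the same pair
  still interact. If in every class both options can be distributed so that each vertex prefers its own
  option to the other one, then the cheaper of two options that together cost at most \<open>d\<^sup>+(v)\<close> is
  taken at \<open>v\<close>, and this is a majority coloring (\<open>majority_of_stabilizable_pairs\<close>). Call a
  choice of pairs with this property stabilizable. It is an assignment of ''colors'' again, now from
  lists of three pairs, and it has to satisfy much less than a majority coloring.

  Stabilizability holds if every class is bipartite (\<open>stabilizable_bipartite\<close>), and it survives the
  addition of a vertex that within its class has no out-neighbor, no in-neighbor, or only one neighbor.
  Lists of three pairs therefore suffice to add a vertex with out-degree at most 2, with in-degree at
  most 2, or with at most 5 neighbors. A minimal set \<open>S\<close> that has no stabilizable choice is therefore
  connected, with all out-degrees and in-degrees at least 3 and at least 6 neighbors at each vertex.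
  The degree conditions of the theorem force exactly 6 neighbors. For the second condition this is
  immediate. Under each of the other two, a vertex of in-degree at least 3 has out-degree at most 4; an
  arc may be deleted at a vertex of out-degree 4, since at most one of three implies at most two of four.
  Then all out-degrees in \<open>S\<close> are 3, and double counting gives in-degree 3.

  A proper coloring of the underlying graph of \<open>S\<close> with colors (pair, bit) would make all classes
  bipartite, so there is none. As there are six such colors at each vertex, \<open>S\<close> is complete on 7
  vertices, by the list version of Brooks' theorem. The proof given here (locale
  \<open>tight_lists\<close>) moves an uncolored vertex around cycles, and yields moreover that all lists
  in \<open>S\<close> coincide. With equal lists there is a stabilizable choice after all, unless each vertex of
  \<open>S\<close> misses at most one of its six possible out-neighbors. This contradicts out-degree 3. Under the
  bound on the underlying graph it leaves components on 7 vertices with out-degrees at least 5, and there any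
  coloring with at most three vertices of each color is a majority coloring.
\<close>

section \<open>Stable choices between two options\<close>

text \<open>
  The price of option \<open>t\<close> for \<open>v\<close>: the fixed charge \<open>b v t\<close>, which stands for all neighbors that
  \<open>v\<close> does not negotiate with, plus the out-neighbors in the class of \<open>v\<close> that take \<open>t\<close> as well.
\<close>

definition option_cost ::
    "('v \<times> 'v) set \<Rightarrow> 'v set \<Rightarrow> ('v \<Rightarrow> 'q) \<Rightarrow> ('v \<Rightarrow> bool \<Rightarrow> nat) \<Rightarrow> ('v \<Rightarrow> bool) \<Rightarrow> 'v \<Rightarrow> bool \<Rightarrow> nat" where
  "option_cost E S q b s v t = b v t + card {w \<in> S. (v, w) \<in> E \<and> q w = q v \<and> s w = t}"

text \<open>
  A pure Nash equilibrium exists for all fixed charges \<open>b\<close>. The quantification over \<open>b\<close> makes the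
  notion inductive: the decisions of vertices that are settled first are absorbed into \<open>b\<close>.
\<close>

definition stabilizable :: "('v \<times> 'v) set \<Rightarrow> 'v set \<Rightarrow> ('v \<Rightarrow> 'q) \<Rightarrow> bool" where
  "stabilizable E S q \<longleftrightarrow>
     (\<forall>b. \<exists>s. \<forall>v\<in>S. option_cost E S q b s v (s v) \<le> option_cost E S q b s v (\<not> s v))"

lemma card_filter_insert:
  assumes "finite S" "v \<notin> S"
  shows "card {w \<in> insert v S. P w} = card {w \<in> S. P w} + of_bool (P v)"
proof (cases "P v")
  case True
  then have "{w \<in> insert v S. P w} = insert v {w \<in> S. P w}" by auto
  then show ?thesis using assms True by simp
next
  case False
  then have "{w \<in> insert v S. P w} = {w \<in> S. P w}" by auto
  then show ?thesis using False by simp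
qed

lemma option_cost_insert:
  assumes "finite S" "v \<notin> S"
  shows "option_cost E (insert v S) q b s u t =
    option_cost E S q b s u t + of_bool ((u, v) \<in> E \<and> q v = q u \<and> s v = t)"
  using card_filter_insert[OF assms, of "\<lambda>w. (u, w) \<in> E \<and> q w = q u \<and> s w = t"]
  by (simp add: option_cost_def)

lemma option_cost_cong:
  assumes "\<And>w. w \<in> S \<Longrightarrow> q w = q' w \<and> s w = s' w" "q u = q' u"
  shows "option_cost E S q b s u t = option_cost E S q' b s' u t"
proof -
  have "{w \<in> S. (u, w) \<in> E \<and> q w = q u \<and> s w = t} = {w \<in> S. (u, w) \<in> E \<and> q' w = q' u \<and> s' w = t}"
    using assms by auto
  then show ?thesis by (simp add: option_cost_def)
qed

lemma option_cost_no_class_arcs: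
  assumes "\<And>w. w \<in> S \<Longrightarrow> (v, w) \<in> E \<Longrightarrow> q w \<noteq> q v"
  shows "option_cost E S q b s v t = b v t"
proof -
  have "{w \<in> S. (v, w) \<in> E \<and> q w = q v \<and> s w = t} = {}" using assms by auto
  then show ?thesis unfolding option_cost_def by (metis add_0_right card.empty)
qed

lemma stabilizable_cong:
  assumes "stabilizable E S q" "\<And>w. w \<in> S \<Longrightarrow> q w = q' w"
  shows "stabilizable E S q'"
  unfolding stabilizable_def
proof
  fix b
  obtain s where "\<forall>v\<in>S. option_cost E S q b s v (s v) \<le> option_cost E S q b s v (\<not> s v)"
    using assms(1) unfolding stabilizable_def by blast
  moreover have "option_cost E S q b s v t = option_cost E S q' b s v t" if "v \<in> S" for v t
    using option_cost_cong[of S q q' s s v] assms(2) that by blast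
  ultimately show "\<exists>s. \<forall>v\<in>S. option_cost E S q' b s v (s v) \<le> option_cost E S q' b s v (\<not> s v)"
    by auto
qed

text \<open>
  Let one side of the bipartition call option \<open>True\<close> ``up'', the other side option \<open>False\<close>. Arcs join
  different sides, so the more neighbors go up, the more attractive it is to go up. Best responses are then
  monotone in the set of vertices that go up, and a fixed point is an equilibrium.
\<close>

lemma stabilizable_bipartite:
  fixes bit :: "'v \<Rightarrow> bool"
  assumes fin: "finite S"
    and bit: "\<And>v w. v \<in> S \<Longrightarrow> w \<in> S \<Longrightarrow> (v, w) \<in> E \<Longrightarrow> q v = q w \<Longrightarrow> bit v \<noteq> bit w"
  shows "stabilizable E S q"
  unfolding stabilizable_def
proof
  fix b :: "'v \<Rightarrow> bool \<Rightarrow> nat"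
  define N where "N v = {w \<in> S. (v, w) \<in> E \<and> q w = q v}" for v
  have finN: "finite (N v)" for v using fin by (simp add: N_def)
  define F where "F A = {v. b v (bit v) + card (N v - A) \<le> b v (\<not> bit v) + card (N v \<inter> A)}" for A
  have "mono F"
  proof (rule monoI)
    fix A B :: "'v set" assume "A \<subseteq> B"
    then have "card (N v - B) \<le> card (N v - A)" "card (N v \<inter> A) \<le> card (N v \<inter> B)" for v
      using finN by (auto intro!: card_mono)
    then show "F A \<subseteq> F B"
      unfolding F_def using add_mono le_trans by (smt (verit) mem_Collect_eq nat_add_left_cancel_le subsetI)
  qed
  define A where "A = lfp F"
  have A: "v \<in> A \<longleftrightarrow> b v (bit v) + card (N v - A) \<le> b v (\<not> bit v) + card (N v \<inter> A)" for v
    using lfp_unfold[OF \<open>mono F\<close>] unfolding A_def[symmetric] F_def by blast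
  define s where "s v = (if v \<in> A then bit v else \<not> bit v)" for v
  have up: "option_cost E S q b s v (bit v) = b v (bit v) + card (N v - A)"
   and down: "option_cost E S q b s v (\<not> bit v) = b v (\<not> bit v) + card (N v \<inter> A)" if "v \<in> S" for v
  proof -
    have "{w \<in> S. (v, w) \<in> E \<and> q w = q v \<and> s w = bit v} = N v - A"
      and "{w \<in> S. (v, w) \<in> E \<and> q w = q v \<and> s w = (\<not> bit v)} = N v \<inter> A"
      using bit[OF that] by (auto simp: N_def s_def split: if_splits)
    then show "option_cost E S q b s v (bit v) = b v (bit v) + card (N v - A)"
      and "option_cost E S q b s v (\<not> bit v) = b v (\<not> bit v) + card (N v \<inter> A)"
      unfolding option_cost_def by metis+
  qed
  have "option_cost E S q b s v (s v) \<le> option_cost E S q b s v (\<not> s v)" if "v \<in> S" for v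
  proof (cases "v \<in> A")
    case True
    then show ?thesis using A[of v] up[OF that] down[OF that] by (simp add: s_def)
  next
    case False
    then show ?thesis using A[of v] up[OF that] down[OF that] by (simp add: s_def)
  qed
  then show "\<exists>s. \<forall>v\<in>S. option_cost E S q b s v (s v) \<le> option_cost E S q b s v (\<not> s v)" by blast
qed

text \<open>
  The new vertex depends on nobody in its class: it decides first, and its decision is added to the
  fixed charges of its in-neighbors.
\<close>

lemma stabilizable_insert_no_out:
  assumes st: "stabilizable E S q" and fin: "finite S" and v: "v \<notin> S" "(v, v) \<notin> E"
    and out: "\<And>w. w \<in> S \<Longrightarrow> (v, w) \<in> E \<Longrightarrow> q w \<noteq> q v"
  shows "stabilizable E (insert v S) q"
  unfolding stabilizable_def
proof
  fix b :: "'a \<Rightarrow> bool \<Rightarrow> nat"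
  define t where "t = (b v True \<le> b v False)"
  define b' where "b' u x = b u x + of_bool ((u, v) \<in> E \<and> q v = q u \<and> t = x)" for u x
  obtain s where s: "\<forall>u\<in>S. option_cost E S q b' s u (s u) \<le> option_cost E S q b' s u (\<not> s u)"
    using st unfolding stabilizable_def by blast
  define s' where "s' = s(v := t)"
  have cost: "option_cost E (insert v S) q b s' u x = option_cost E S q b' s u x" for u x
  proof -
    have "option_cost E S q b s' u x = option_cost E S q b s u x"
      by (rule option_cost_cong) (use v in \<open>auto simp: s'_def\<close>)
    then show ?thesis
      unfolding option_cost_insert[OF fin v(1)] by (simp add: s'_def b'_def option_cost_def)
  qed
  have "option_cost E (insert v S) q b s' v x = b v x" for x
    using option_cost_no_class_arcs[of "insert v S" v E q b s' x] out v(2) by blast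
  moreover have "b v t \<le> b v (\<not> t)" by (cases "b v True \<le> b v False") (auto simp: t_def)
  ultimately have "option_cost E (insert v S) q b s' v (s' v) \<le> option_cost E (insert v S) q b s' v (\<not> s' v)"
    by (simp add: s'_def)
  moreover have "option_cost E (insert v S) q b s' u (s' u) \<le> option_cost E (insert v S) q b s' u (\<not> s' u)"
    if "u \<in> S" for u
    using s that v(1) unfolding cost by (auto simp: s'_def)
  ultimately show "\<exists>s. \<forall>u\<in>insert v S. option_cost E (insert v S) q b s u (s u)
      \<le> option_cost E (insert v S) q b s u (\<not> s u)"
    by blast
qed

text \<open>
  Nobody in its class depends on the new vertex, so it decides last.
\<close>

lemma stabilizable_insert_no_in:
  assumes st: "stabilizable E S q" and fin: "finite S" and v: "v \<notin> S" "(v, v) \<notin> E"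
    and into: "\<And>w. w \<in> S \<Longrightarrow> (w, v) \<in> E \<Longrightarrow> q w \<noteq> q v"
  shows "stabilizable E (insert v S) q"
  unfolding stabilizable_def
proof
  fix b :: "'a \<Rightarrow> bool \<Rightarrow> nat"
  obtain s where s: "\<forall>u\<in>S. option_cost E S q b s u (s u) \<le> option_cost E S q b s u (\<not> s u)"
    using st unfolding stabilizable_def by blast
  define t where "t = (option_cost E S q b s v True \<le> option_cost E S q b s v False)"
  define s' where "s' = s(v := t)"
  have cost: "option_cost E (insert v S) q b s' u x = option_cost E S q b s u x" if "u \<in> insert v S" for u x
  proof -
    have "option_cost E S q b s' u x = option_cost E S q b s u x"
      by (rule option_cost_cong) (use v in \<open>auto simp: s'_def\<close>)
    moreover have "\<not> ((u, v) \<in> E \<and> q v = q u)" using into v(2) that by force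
    ultimately show ?thesis
      unfolding option_cost_insert[OF fin v(1)] by auto
  qed
  have "option_cost E S q b s v t \<le> option_cost E S q b s v (\<not> t)"
    by (cases "option_cost E S q b s v True \<le> option_cost E S q b s v False") (auto simp: t_def)
  then have "option_cost E (insert v S) q b s' u (s' u) \<le> option_cost E (insert v S) q b s' u (\<not> s' u)"
    if "u \<in> insert v S" for u
    using s that v(1) unfolding cost[OF that] by (auto simp: s'_def)
  then show "\<exists>s. \<forall>u\<in>insert v S. option_cost E (insert v S) q b s u (s u)
      \<le> option_cost E (insert v S) q b s u (\<not> s u)"
    by blast
qed

text \<open>
  A single unit of interaction decides the choice of \<open>v\<close> only in a tie. Without a tie \<open>v\<close> takes its
  cheaper option beforehand; in a tie it takes the option opposite to that of \<open>x\<close>, which never hurts \<open>x\<close>.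
\<close>

lemma stabilizable_insert_one_neighbor:
  assumes st: "stabilizable E S q" and fin: "finite S" and v: "v \<notin> S" "(v, v) \<notin> E"
    and x: "\<And>w. w \<in> S \<Longrightarrow> (v, w) \<in> E \<or> (w, v) \<in> E \<Longrightarrow> q w = q v \<Longrightarrow> w = x"
  shows "stabilizable E (insert v S) q"
  unfolding stabilizable_def
proof
  fix b :: "'a \<Rightarrow> bool \<Rightarrow> nat"
  show "\<exists>s. \<forall>u\<in>insert v S. option_cost E (insert v S) q b s u (s u)
      \<le> option_cost E (insert v S) q b s u (\<not> s u)"
  proof (cases "b v True = b v False")
    case True
    obtain s where s: "\<forall>u\<in>S. option_cost E S q b s u (s u) \<le> option_cost E S q b s u (\<not> s u)"
      using st unfolding stabilizable_def by blast
    define s' where "s' = s(v := \<not> s x)"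
    have cost: "option_cost E (insert v S) q b s' u y
        = option_cost E S q b s u y + of_bool ((u, v) \<in> E \<and> q v = q u \<and> (\<not> s x) = y)" for u y
    proof -
      have "option_cost E S q b s' u y = option_cost E S q b s u y"
        by (rule option_cost_cong) (use v in \<open>auto simp: s'_def\<close>)
      then show ?thesis by (simp add: option_cost_insert[OF fin v(1)] s'_def)
    qed
    have "option_cost E (insert v S) q b s' u (s' u) \<le> option_cost E (insert v S) q b s' u (\<not> s' u)"
      if "u \<in> insert v S" for u
    proof (cases "u = v")
      case True
      have "{w \<in> S. (v, w) \<in> E \<and> q w = q v \<and> s w = (\<not> s x)} = {}" using x by auto
      then have "option_cost E S q b s v (\<not> s x) = b v (\<not> s x)"
        unfolding option_cost_def by (metis add_0_right card.empty)
      then show ?thesis using True \<open>b v True = b v False\<close> v(2)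
        unfolding cost by (cases "s x") (auto simp: s'_def option_cost_def)
    next
      case False
      then have u: "u \<in> S" using that by blast
      then have "\<not> ((u, v) \<in> E \<and> q v = q u \<and> (\<not> s x) = s u)" using x by metis
      then show ?thesis using s u False unfolding cost by (auto simp: s'_def intro: le_SucI)
    qed
    then show ?thesis by blast
  next
    case False
    define t where "t = (b v True \<le> b v False)"
    have t: "Suc (b v t) \<le> b v (\<not> t)"
      using False by (cases "b v True \<le> b v False") (auto simp: t_def)
    define b' where "b' u x = b u x + of_bool ((u, v) \<in> E \<and> q v = q u \<and> t = x)" for u x
    obtain s where s: "\<forall>u\<in>S. option_cost E S q b' s u (s u) \<le> option_cost E S q b' s u (\<not> s u)"
      using st unfolding stabilizable_def by blast
    define s' where "s' = s(v := t)"
    have cost: "option_cost E (insert v S) q b s' u y = option_cost E S q b' s u y" for u y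
    proof -
      have "option_cost E S q b s' u y = option_cost E S q b s u y"
        by (rule option_cost_cong) (use v in \<open>auto simp: s'_def\<close>)
      then show ?thesis
        unfolding option_cost_insert[OF fin v(1)] by (simp add: s'_def b'_def option_cost_def)
    qed
    \<comment> \<open>Only \<open>x\<close> can raise the price of \<open>t\<close>, by one unit; the other option is dearer by at least that.\<close>
    have "{w \<in> insert v S. (v, w) \<in> E \<and> q w = q v \<and> s' w = t} \<subseteq> {x}" using x v(2) by auto
    then have "card {w \<in> insert v S. (v, w) \<in> E \<and> q w = q v \<and> s' w = t} \<le> 1"
      using card_mono[of "{x}"] by simp
    then have "option_cost E (insert v S) q b s' v (s' v) \<le> option_cost E (insert v S) q b s' v (\<not> s' v)"
      using t by (simp add: s'_def option_cost_def)
    moreover have "option_cost E (insert v S) q b s' u (s' u) \<le> option_cost E (insert v S) q b s' u (\<not> s' u)"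
      if "u \<in> S" for u
      using s that v(1) unfolding cost by (auto simp: s'_def)
    ultimately show ?thesis by blast
  qed
qed

lemma stabilizable_Un:
  assumes A: "stabilizable E A q" and B: "stabilizable E B q" and fin: "finite A" "finite B"
    and dis: "A \<inter> B = {}"
    and sep: "\<And>u w. u \<in> A \<Longrightarrow> w \<in> B \<Longrightarrow> (u, w) \<notin> E \<and> (w, u) \<notin> E"
  shows "stabilizable E (A \<union> B) q"
  unfolding stabilizable_def
proof
  fix b :: "'a \<Rightarrow> bool \<Rightarrow> nat"
  obtain s where s: "\<forall>u\<in>A. option_cost E A q b s u (s u) \<le> option_cost E A q b s u (\<not> s u)"
    using A unfolding stabilizable_def by blast
  obtain s' where s': "\<forall>u\<in>B. option_cost E B q b s' u (s' u) \<le> option_cost E B q b s' u (\<not> s' u)"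
    using B unfolding stabilizable_def by blast
  define r where "r v = (if v \<in> A then s v else s' v)" for v
  have "option_cost E (A \<union> B) q b r u t = option_cost E A q b s u t" if "u \<in> A" for u t
  proof -
    have "{w \<in> A \<union> B. (u, w) \<in> E \<and> q w = q u \<and> r w = t} = {w \<in> A. (u, w) \<in> E \<and> q w = q u \<and> s w = t}"
      using that sep by (auto simp: r_def)
    then show ?thesis by (simp add: option_cost_def)
  qed
  moreover have "option_cost E (A \<union> B) q b r u t = option_cost E B q b s' u t" if "u \<in> B" for u t
  proof -
    have "{w \<in> A \<union> B. (u, w) \<in> E \<and> q w = q u \<and> r w = t} = {w \<in> B. (u, w) \<in> E \<and> q w = q u \<and> s' w = t}"
      using that sep dis by (auto simp: r_def)
    then show ?thesis by (simp add: option_cost_def)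
  qed
  ultimately have "\<forall>u\<in>A \<union> B. option_cost E (A \<union> B) q b r u (r u) \<le> option_cost E (A \<union> B) q b r u (\<not> r u)"
    using s s' dis by (auto simp: r_def)
  then show "\<exists>s. \<forall>u\<in>A \<union> B. option_cost E (A \<union> B) q b s u (s u) \<le> option_cost E (A \<union> B) q b s u (\<not> s u)"
    by blast
qed

section \<open>Brooks' theorem for lists on a linked set\<close>

text \<open>
  Connectedness, expressed by cuts: this is the form that minimality of a bad set delivers and that
  greedy coloring consumes.
\<close>

definition linked :: "('v \<Rightarrow> 'v \<Rightarrow> bool) \<Rightarrow> 'v set \<Rightarrow> bool" where
  "linked adj S \<longleftrightarrow> (\<forall>X. X \<subset> S \<longrightarrow> X \<noteq> {} \<longrightarrow> (\<exists>v\<in>X. \<exists>w\<in>S - X. adj v w))"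

lemma linked_boundary:
  assumes "linked adj S" "X \<subset> S" "X \<noteq> {}"
  obtains v w where "v \<in> X" "w \<in> S - X" "adj v w"
  using assms unfolding linked_def by meson

lemma linked_walk:
  assumes S: "linked adj S" and u: "u \<in> S" and v: "v \<in> S"
  shows "\<exists>vs. vs \<noteq> [] \<and> hd vs = u \<and> last vs = v \<and> set vs \<subseteq> S \<and> successively adj vs"
proof -
  define R where "R = {v \<in> S. \<exists>vs. vs \<noteq> [] \<and> hd vs = u \<and> last vs = v \<and> set vs \<subseteq> S \<and> successively adj vs}"
  have "u \<in> R" using u by (auto simp: R_def intro!: exI[of _ "[u]"])
  have "R = S"
  proof (rule ccontr)
    assume "R \<noteq> S"
    then have "R \<subset> S" "R \<noteq> {}" using \<open>u \<in> R\<close> by (auto simp: R_def)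
    then obtain a b where ab: "a \<in> R" "b \<in> S - R" "adj a b" by (rule linked_boundary[OF S])
    then obtain vs where vs: "vs \<noteq> []" "hd vs = u" "last vs = a" "set vs \<subseteq> S" "successively adj vs"
      by (auto simp: R_def)
    then have "b \<in> R" using ab unfolding R_def
      by (auto intro!: exI[of _ "vs @ [b]"] simp: successively_append_iff)
    then show False using ab by blast
  qed
  then show ?thesis using v by (auto simp: R_def)
qed

text \<open>
  A maximal proper connected subset can be enlarged by a boundary vertex, and by maximality
  this yields everything.
\<close>

lemma linked_remove_vertex:
  assumes S: "linked adj S" "finite S" and sym: "\<And>u v. adj u v \<Longrightarrow> adj v u"
    and two: "x \<in> S" "y \<in> S" "x \<noteq> y"
  shows "\<exists>r\<in>S. linked adj (S - {r})"
proof -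
  define F where "F = {X. X \<subset> S \<and> X \<noteq> {} \<and> linked adj X}"
  have "{x} \<in> F" using two by (auto simp: F_def linked_def)
  moreover have "finite F" using S(2) by (auto simp: F_def intro: finite_subset[of _ "Pow S"])
  ultimately obtain X where X: "X \<in> F" and max: "\<And>Y. Y \<in> F \<Longrightarrow> X \<subseteq> Y \<Longrightarrow> X = Y"
    using finite_has_maximal[of F] by blast
  then have "X \<subset> S" "X \<noteq> {}" by (auto simp: F_def)
  then obtain v w where vw: "v \<in> X" "w \<in> S - X" "adj v w" by (rule linked_boundary[OF S(1)])
  have "linked adj (insert w X)"
    unfolding linked_def
  proof (intro allI impI)
    fix Y assume Y: "Y \<subset> insert w X" "Y \<noteq> {}"
    show "\<exists>a\<in>Y. \<exists>b\<in>insert w X - Y. adj a b"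
    proof (cases "Y \<inter> X = {} \<or> Y = X")
      case True
      then have "Y = {w} \<or> Y = X" using Y by blast
      then show ?thesis using vw sym by blast
    next
      case False
      then have "Y \<inter> X \<subset> X" "Y \<inter> X \<noteq> {}" using Y by auto
      moreover have "linked adj X" using X by (simp add: F_def)
      ultimately obtain a b where "a \<in> Y \<inter> X" "b \<in> X - (Y \<inter> X)" "adj a b"
        using linked_boundary by metis
      then show ?thesis by blast
    qed
  qed
  then have "insert w X \<notin> F" using max[of "insert w X"] vw by blast
  then have "insert w X = S" using \<open>linked adj (insert w X)\<close> X vw by (auto simp: F_def)
  then have "S - {w} = X" using vw by blast
  then show ?thesis using X vw by (auto simp: F_def)
qed

text \<open>
  Shortest walks are paths.
\<close>

lemma shortcut_walk:
  assumes "\<not> distinct vs" "successively R vs"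
  shows "\<exists>ws. ws \<noteq> [] \<and> length ws < length vs \<and> set ws \<subseteq> set vs \<and> successively R ws
    \<and> hd ws = hd vs \<and> last ws = last vs"
proof -
  obtain xs ys zs y where vs: "vs = xs @ [y] @ ys @ [y] @ zs"
    using not_distinct_decomp[OF assms(1)] by blast
  then have "successively R (xs @ [y] @ zs)"
    using assms(2) by (auto simp: successively_append_iff successively_Cons)
  then show ?thesis unfolding vs by (intro exI[of _ "xs @ [y] @ zs"]) (auto simp: hd_append)
qed

definition proper_coloring :: "('v \<Rightarrow> 'v \<Rightarrow> bool) \<Rightarrow> ('v \<Rightarrow> 'c set) \<Rightarrow> 'v set \<Rightarrow> ('v \<Rightarrow> 'c) \<Rightarrow> bool" where
  "proper_coloring adj \<Lambda> T \<phi> \<longleftrightarrow> (\<forall>v\<in>T. \<phi> v \<in> \<Lambda> v \<and> (\<forall>w\<in>T. adj v w \<longrightarrow> \<phi> v \<noteq> \<phi> w))"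

lemma proper_coloring_of_degenerate:
  assumes "finite T" and sym: "\<And>u v. adj u v \<Longrightarrow> adj v u" and irrefl: "\<And>v. \<not> adj v v"
    and "\<And>X. X \<subseteq> T \<Longrightarrow> X \<noteq> {} \<Longrightarrow> \<exists>v\<in>X. card {w \<in> X. adj v w} < card (\<Lambda> v)"
  shows "\<exists>\<phi>. proper_coloring adj \<Lambda> T \<phi>"
  using assms(1,4)
proof (induction T rule: finite_psubset_induct)
  case (psubset T)
  show ?case
  proof (cases "T = {}")
    case True
    then show ?thesis by (simp add: proper_coloring_def)
  next
    case False
    then obtain v where v: "v \<in> T" "card {w \<in> T. adj v w} < card (\<Lambda> v)" using psubset.prems[of T] by auto
    have "\<exists>\<phi>. proper_coloring adj \<Lambda> (T - {v}) \<phi>"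
      by (rule psubset.IH) (use v psubset.prems in \<open>(blast | meson Diff_subset subset_trans)+\<close>)
    then obtain \<phi> where \<phi>: "proper_coloring adj \<Lambda> (T - {v}) \<phi>" by blast
    have "card (\<phi> ` {w \<in> T. adj v w}) < card (\<Lambda> v)"
      using card_image_le[of "{w \<in> T. adj v w}" \<phi>] v psubset.hyps by simp
    then have "\<not> \<Lambda> v \<subseteq> \<phi> ` {w \<in> T. adj v w}"
      using card_mono[of "\<phi> ` {w \<in> T. adj v w}" "\<Lambda> v"] psubset.hyps by auto
    then obtain a where a: "a \<in> \<Lambda> v" "a \<notin> \<phi> ` {w \<in> T. adj v w}" by blast
    have "proper_coloring adj \<Lambda> T (\<phi>(v := a))"
      using \<phi> a sym irrefl unfolding proper_coloring_def by auto
    then show ?thesis by blast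
  qed
qed

text \<open>
  The uncolored vertex \<open>h\<close> walks along the list; each vertex takes the color of the next one.
\<close>

fun shift_along :: "('v \<Rightarrow> 'c) \<Rightarrow> 'v \<Rightarrow> 'v list \<Rightarrow> 'v \<Rightarrow> 'c" where
  "shift_along \<phi> h [] = \<phi>"
| "shift_along \<phi> h (x # xs) = shift_along (\<phi>(h := \<phi> x)) x xs"

lemma shift_along_outside: "u \<notin> set (h # xs) \<Longrightarrow> shift_along \<phi> h xs u = \<phi> u"
  by (induction xs arbitrary: h \<phi>) auto

lemma shift_along_nth:
  "distinct (h # xs) \<Longrightarrow> i < length xs \<Longrightarrow> shift_along \<phi> h xs ((h # xs) ! i) = \<phi> (xs ! i)"
proof (induction xs arbitrary: h \<phi> i)
  case (Cons x xs)
  show ?case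
  proof (cases i)
    case 0
    then show ?thesis using Cons.prems by (simp add: shift_along_outside)
  next
    case (Suc j)
    then have "shift_along (\<phi>(h := \<phi> x)) x xs ((x # xs) ! j) = (\<phi>(h := \<phi> x)) (xs ! j)"
      using Cons.prems by (intro Cons.IH) auto
    moreover have "xs ! j \<noteq> h" using Cons.prems Suc by auto
    ultimately show ?thesis using Suc by simp
  qed
qed simp

text \<open>
  The exceptional case of Brooks' theorem, with the size of the lists equal to the degree: the aim is to
  show that such a graph is complete.
\<close>

locale tight_lists =
  fixes adj :: "'v \<Rightarrow> 'v \<Rightarrow> bool" and S :: "'v set" and \<Lambda> :: "'v \<Rightarrow> 'c set" and d :: nat
  assumes finite_S: "finite S"
    and adj_sym: "adj u v \<Longrightarrow> adj v u"
    and adj_irrefl: "\<not> adj v v"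
    and linked_S: "linked adj S"
    and degree: "v \<in> S \<Longrightarrow> card {w \<in> S. adj v w} = d"
    and card_list: "v \<in> S \<Longrightarrow> card (\<Lambda> v) = d"
    and three_le_d: "3 \<le> d"
    and uncolorable: "\<not> proper_coloring adj \<Lambda> S \<phi>"
begin

definition nbrs :: "'v \<Rightarrow> 'v set" where
  "nbrs v = {w \<in> S. adj v w}"

lemma successively_adj_rev: "successively adj (rev xs) = successively adj xs"
proof -
  have "(\<lambda>a b. adj b a) = adj" using adj_sym by (intro ext) blast
  from arg_cong[OF this, of "\<lambda>R. successively R xs"] show ?thesis by (simp only: successively_rev)
qed

text \<open>
  All vertices are properly colored except \<open>r\<close>; the value of \<open>\<phi>\<close> at \<open>r\<close> is meaningless.
\<close>

definition hole :: "'v \<Rightarrow> ('v \<Rightarrow> 'c) \<Rightarrow> bool" where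
  "hole r \<phi> \<longleftrightarrow> r \<in> S \<and> proper_coloring adj \<Lambda> (S - {r}) \<phi>"

text \<open>
  Every proper subset loses an edge at its boundary, so it contains a vertex with fewer neighbors than
  colors, and greedy coloring reaches everything but \<open>r\<close>.
\<close>

lemma hole_exists:
  assumes "r \<in> S"
  shows "\<exists>\<phi>. hole r \<phi>"
proof -
  have "\<exists>\<phi>. proper_coloring adj \<Lambda> (S - {r}) \<phi>"
  proof (rule proper_coloring_of_degenerate)
    fix X assume X: "X \<subseteq> S - {r}" "X \<noteq> {}"
    then have "X \<subset> S" using assms by blast
    then obtain v w where vw: "v \<in> X" "w \<in> S - X" "adj v w"
      using linked_boundary[OF linked_S _ X(2)] by blast
    have "{u \<in> X. adj v u} \<subset> {u \<in> S. adj v u}" using X vw by blast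
    then have "card {u \<in> X. adj v u} < d"
      using psubset_card_mono[of "{u \<in> S. adj v u}"] finite_S degree[of v] X vw by auto
    then show "\<exists>v\<in>X. card {u \<in> X. adj v u} < card (\<Lambda> v)" using card_list X vw by auto
  qed (use finite_S adj_sym adj_irrefl in auto)
  then show ?thesis using assms by (simp add: hole_def)
qed

text \<open>
  Otherwise a color would be free for the hole.
\<close>

lemma hole_bij:
  assumes "hole r \<phi>"
  shows "bij_betw \<phi> (nbrs r) (\<Lambda> r)"
proof -
  have r: "r \<in> S" and \<phi>: "proper_coloring adj \<Lambda> (S - {r}) \<phi>" using assms by (auto simp: hole_def)
  have fin: "finite (nbrs r)" using finite_S by (simp add: nbrs_def)
  have "\<Lambda> r \<subseteq> \<phi> ` nbrs r"
  proof (rule ccontr)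
    assume "\<not> \<Lambda> r \<subseteq> \<phi> ` nbrs r"
    then obtain a where "a \<in> \<Lambda> r" "a \<notin> \<phi> ` nbrs r" by blast
    then have "proper_coloring adj \<Lambda> S (\<phi>(r := a))"
      using \<phi> adj_sym adj_irrefl unfolding proper_coloring_def nbrs_def by auto
    then show False using uncolorable by blast
  qed
  moreover have "card (nbrs r) = card (\<Lambda> r)" using degree card_list r by (simp add: nbrs_def)
  ultimately have eq: "\<Lambda> r = \<phi> ` nbrs r"
    using fin by (metis card_image_le card_seteq finite_imageI)
  then have "inj_on \<phi> (nbrs r)" using fin \<open>card (nbrs r) = card (\<Lambda> r)\<close> by (simp add: eq_card_imp_inj_on)
  then show ?thesis using eq by (simp add: bij_betw_def)
qed

lemma hole_inj: "hole r \<phi> \<Longrightarrow> u \<in> nbrs r \<Longrightarrow> v \<in> nbrs r \<Longrightarrow> \<phi> u = \<phi> v \<Longrightarrow> u = v"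
  using hole_bij bij_betw_imp_inj_on inj_onD by metis

text \<open>
  The neighbors of the hole use every color of its list exactly once. Hence the hole may take over
  the color of any neighbor, which becomes the new hole, without regard to differing lists.
\<close>

lemma hole_step:
  assumes "hole r \<phi>" "x \<in> nbrs r"
  shows "hole x (\<phi>(r := \<phi> x))"
proof -
  have "\<phi> x \<in> \<Lambda> r" using hole_bij[OF assms(1)] assms(2) bij_betwE by blast
  moreover have "\<phi> x \<noteq> \<phi> w \<and> \<phi> w \<noteq> \<phi> x" if "w \<in> S" "w \<noteq> x" "adj r w \<or> adj w r" for w
    using hole_inj[OF assms, of w] that adj_sym by (auto simp: nbrs_def)
  ultimately show ?thesis
    using assms adj_sym adj_irrefl unfolding hole_def proper_coloring_def nbrs_def by auto
qed

lemma hole_walk: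
  "hole r \<phi> \<Longrightarrow> successively adj (r # xs) \<Longrightarrow> set xs \<subseteq> S \<Longrightarrow> hole (last (r # xs)) (shift_along \<phi> r xs)"
proof (induction xs arbitrary: r \<phi>)
  case (Cons x xs)
  then have "hole x (\<phi>(r := \<phi> x))" by (intro hole_step) (auto simp: nbrs_def)
  then have "hole (last (x # xs)) (shift_along (\<phi>(r := \<phi> x)) x xs)"
    by (rule Cons.IH) (use Cons.prems in auto)
  then show ?case by (simp only: shift_along.simps last_ConsR list.distinct not_False_eq_True)
qed simp

text \<open>
  A hole that walks once around a cycle comes back, and the colors on the cycle have moved on
  by one vertex.
\<close>

lemma rotate_cycle:
  assumes "hole r \<phi>" "successively adj vs" "distinct vs" "set vs \<subseteq> S - {r}" "vs \<noteq> []"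
    "adj r (hd vs)" "adj r (last vs)"
  shows "\<exists>\<psi>. hole r \<psi> \<and> (\<forall>i. Suc i < length vs \<longrightarrow> \<psi> (vs ! i) = \<phi> (vs ! Suc i))
    \<and> \<psi> (last vs) = \<phi> (hd vs) \<and> (\<forall>u. u \<noteq> r \<longrightarrow> u \<notin> set vs \<longrightarrow> \<psi> u = \<phi> u)"
proof -
  define \<chi> where "\<chi> = shift_along \<phi> r vs"
  define \<psi> where "\<psi> = \<chi>(last vs := \<chi> r)"
  have dist: "distinct (r # vs)" using assms by auto
  have r: "\<chi> r = \<phi> (hd vs)"
    using shift_along_nth[OF dist, of 0 \<phi>] assms(5) by (simp add: \<chi>_def hd_conv_nth)
  have "successively adj (r # vs)" using assms by (simp add: successively_Cons)
  then have "hole (last vs) \<chi>"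
    using hole_walk[OF assms(1), of vs] assms(4,5) by (auto simp: \<chi>_def)
  moreover have "r \<in> nbrs (last vs)" using assms(1,7) adj_sym by (simp add: nbrs_def hole_def)
  ultimately have "hole r \<psi>" unfolding \<psi>_def by (rule hole_step)
  moreover have "\<psi> (vs ! i) = \<phi> (vs ! Suc i)" if i: "Suc i < length vs" for i
  proof -
    have "vs ! i \<noteq> last vs"
      using i assms(3,5) nth_eq_iff_index_eq[OF assms(3), of i "length vs - 1"] by (simp add: last_conv_nth)
    then show ?thesis using shift_along_nth[OF dist, of "Suc i" \<phi>] i by (simp add: \<psi>_def \<chi>_def)
  qed
  moreover have "\<psi> u = \<phi> u" if "u \<noteq> r" "u \<notin> set vs" for u
    using that assms(5) shift_along_outside[of u r vs \<phi>] last_in_set by (auto simp: \<psi>_def \<chi>_def)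
  ultimately show ?thesis using r by (intro exI[of _ \<psi>]) (auto simp: \<psi>_def)
qed

text \<open>
  Among the neighbors of the hole, rotation recolors only \<open>x\<close> and \<open>y\<close>: \<open>y\<close> gets the color of \<open>x\<close>,
  and \<open>x\<close> that of the next vertex \<open>z\<close>. Since the neighbors of \<open>r\<close> must show all colors of the list
  of \<open>r\<close> before and after, the color that \<open>y\<close> gave up reappears at \<open>x\<close>.
\<close>

lemma chordless_cycle:
  assumes h: "hole r \<phi>" and vs: "successively adj (x # z # zs)" "distinct (x # z # zs)"
      "set (x # z # zs) \<subseteq> S - {r}"
    and ends: "nbrs r \<inter> set (x # z # zs) = {x, y}" "y = last (z # zs)"
  shows "\<phi> z = \<phi> y"
proof -
  have xy: "x \<in> nbrs r" "y \<in> nbrs r" using ends(1) by blast+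
  have "y \<in> set (z # zs)" unfolding ends(2) by (rule last_in_set) simp
  then have ne: "x \<noteq> y" using vs(2) by auto
  have nonempty: "x # z # zs \<noteq> []"
    and adj_ends: "adj r (hd (x # z # zs))" "adj r (last (x # z # zs))"
    using xy unfolding ends(2) nbrs_def by simp_all
  obtain \<psi> where \<psi>: "hole r \<psi>"
    "\<forall>i. Suc i < length (x # z # zs) \<longrightarrow> \<psi> ((x # z # zs) ! i) = \<phi> ((x # z # zs) ! Suc i)"
    "\<psi> (last (x # z # zs)) = \<phi> (hd (x # z # zs))"
    "\<forall>u. u \<noteq> r \<longrightarrow> u \<notin> set (x # z # zs) \<longrightarrow> \<psi> u = \<phi> u"
    using rotate_cycle[OF h vs nonempty adj_ends] by blast
  have \<psi>x: "\<psi> x = \<phi> z" using \<psi>(2)[rule_format, of 0] by simp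
  have \<psi>y: "\<psi> y = \<phi> x" using \<psi>(3) unfolding ends(2) by simp
  have "\<phi> y \<in> \<psi> ` nbrs r" using hole_bij[OF h] hole_bij[OF \<psi>(1)] xy(2) unfolding bij_betw_def by blast
  then obtain u where u: "u \<in> nbrs r" "\<psi> u = \<phi> y" by force
  have "u = x"
  proof (rule ccontr)
    assume "u \<noteq> x"
    moreover have "u \<noteq> y" using u(2) \<psi>y hole_inj[OF h xy] ne by metis
    ultimately have "u \<notin> set (x # z # zs)" using u(1) ends(1) by blast
    moreover have "u \<noteq> r" using u(1) adj_irrefl by (auto simp: nbrs_def)
    ultimately have "\<phi> u = \<phi> y" using \<psi>(4) u(2) by metis
    then show False using hole_inj[OF h u(1) xy(2)] \<open>u \<noteq> y\<close> by blast
  qed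
  then show ?thesis using u(2) \<psi>x by simp
qed

text \<open>
  If not, the 4-cycle through the hole \<open>x\<close>, then \<open>r\<close>, \<open>y\<close> and \<open>z\<close> has no chord at \<open>x\<close>, which gives the adjacent vertices
  \<open>y\<close> and \<open>z\<close> the same color.
\<close>

lemma diamond:
  assumes "r \<in> S" "z \<in> S" "x \<in> S" "y \<in> S" "adj r z" "adj x r" "adj x z" "adj y r" "adj y z" "x \<noteq> y"
  shows "adj x y"
proof (rule ccontr)
  assume nadj: "\<not> adj x y"
  obtain \<phi> where h: "hole x \<phi>" using hole_exists assms by blast
  have dist: "x \<noteq> r" "x \<noteq> z" "y \<noteq> r" "y \<noteq> z" "r \<noteq> z" using assms adj_irrefl by auto
  have "\<phi> y = \<phi> z"
    by (rule chordless_cycle[OF h, of r y "[z]" z])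
      (use assms dist nadj adj_sym in \<open>auto simp: nbrs_def\<close>)
  moreover have "\<phi> y \<noteq> \<phi> z"
    using h assms dist unfolding hole_def proper_coloring_def by blast
  ultimately show False by blast
qed

text \<open>
  A chordless cycle through the hole, formed by \<open>r\<close> and the path \<open>vs\<close>, cannot have a second path \<open>qs\<close> that
  leads from a third neighbor of \<open>r\<close> to it. If \<open>qs\<close> ends at an interior vertex, then \<open>vs\<close> and the detour
  via \<open>qs\<close> are chordless cycles with the same vertex after \<open>last vs\<close>, whose color would be that of
  two different neighbors of \<open>r\<close>. If \<open>qs\<close> ends at \<open>last vs\<close>, rotation of the cycle along \<open>qs\<close> changes the color
  of \<open>last vs\<close> and of no other vertex on \<open>vs\<close>, so that \<open>chordless_cycle\<close> fails before or after.
\<close>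

lemma no_attached_path:
  assumes h: "hole r \<phi>"
    and vs: "successively adj vs" "distinct vs" "set vs \<subseteq> S - {r}" "3 \<le> length vs"
      "nbrs r \<inter> set vs = {hd vs, last vs}"
    and qs: "qs \<noteq> []" "successively adj qs" "distinct qs" "set qs \<subseteq> S - {r}" "hd qs \<in> nbrs r"
      "hd qs \<notin> set vs" "set (butlast qs) \<inter> set vs = {}"
      "nbrs r \<inter> set (tl qs) \<subseteq> {hd vs, last vs}"
    and q: "last qs \<in> set vs" "last qs \<noteq> hd vs"
  shows False
proof -
  define x where "x = hd vs"
  define y where "y = last vs"
  define w where "w = hd qs"
  define q where "q = last qs"
  have xy: "x \<in> nbrs r" "y \<in> nbrs r" "w \<in> nbrs r" "x \<in> set vs" "y \<in> set vs"
    using vs(5) qs(5) by (auto simp: x_def y_def w_def)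
  have w: "w \<noteq> x" "w \<noteq> y" using qs(6) xy by (auto simp: w_def)
  obtain as bs where vs_eq: "vs = as @ q # bs" using q(1) unfolding q_def by (meson split_list)
  have "as \<noteq> []" using vs_eq q(2) by (auto simp: q_def)
  obtain ps where ps: "qs = ps @ [q]" using qs(1) unfolding q_def by (metis append_butlast_last_id)
  have "ps \<noteq> []" using qs(6) q(1) by (auto simp: ps)
  then obtain qs' where qs': "ps = w # qs'"
    by (cases ps) (auto simp: w_def ps)
  have ps_vs: "set ps \<inter> set vs = {}" using qs(7) by (simp add: ps)
  show False
  proof (cases "bs = []")
    case True
    then have "q = y" using vs_eq by (simp add: y_def)
    then obtain z zs where as: "as = x # z # zs"
      using vs_eq vs(4) True by (cases as; cases "tl as") (auto simp: x_def)
    have vs_eq': "vs = x # z # (zs @ [y])" using vs_eq as True \<open>q = y\<close> by simp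
    have rule: "\<chi> z = \<chi> y" if "hole r \<chi>" for \<chi>
      using chordless_cycle[OF that, of x z "zs @ [y]" y] vs vs_eq' by (simp add: x_def[symmetric] y_def[symmetric])
    have "adj r (hd qs)" "adj r (last qs)"
      using xy \<open>q = y\<close> by (auto simp: w_def[symmetric] q_def[symmetric] nbrs_def)
    from rotate_cycle[OF h qs(2,3,4,1) this]
    obtain \<psi> where \<psi>: "hole r \<psi>" "\<psi> (last qs) = \<phi> (hd qs)" "\<forall>u. u \<noteq> r \<longrightarrow> u \<notin> set qs \<longrightarrow> \<psi> u = \<phi> u"
      by blast
    have "z \<in> set vs" "z \<noteq> y" "z \<noteq> r" using vs_eq' vs(2,3) by auto
    then have "z \<notin> set qs" using ps_vs \<open>q = y\<close> by (auto simp: ps)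
    then have "\<psi> z = \<phi> z" using \<psi>(3) \<open>z \<noteq> r\<close> by blast
    then have "\<phi> w = \<phi> y" using rule[OF h] rule[OF \<psi>(1)] \<psi>(2) \<open>q = y\<close> by (simp add: q_def w_def)
    then show False using hole_inj[OF h xy(3,2)] w by blast
  next
    case False
    then obtain bs' where bs: "bs = bs' @ [y]" using vs_eq by (metis append_butlast_last_id last.simps last_appendR list.distinct(1) y_def)
    obtain u us where u: "rev bs' @ [q] = u # us" by (cases "rev bs' @ [q]") auto
    have rv: "rev vs = y # u # (us @ rev as)"
      using arg_cong[OF u, of "\<lambda>xs. y # xs @ rev as"] by (simp add: vs_eq bs)
    \<comment> \<open>Seen from \<open>y\<close>, both cycles start with the same vertex \<open>u\<close>.\<close>
    have cs: "rev (qs @ bs) = y # u # (us @ rev ps)"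
      using arg_cong[OF u, of "\<lambda>xs. y # xs @ rev ps"] by (simp add: bs ps)
    have hd_vs: "hd vs = last (rev as)" "last (rev as) = x" using \<open>as \<noteq> []\<close> vs_eq by (auto simp: x_def last_rev)
    have "\<phi> u = \<phi> x"
    proof (rule chordless_cycle[OF h, of y u "us @ rev as" x])
      show "successively adj (y # u # us @ rev as)"
        using vs(1) unfolding rv[symmetric] by (simp only: successively_adj_rev)
      show "distinct (y # u # us @ rev as)" "set (y # u # us @ rev as) \<subseteq> S - {r}"
        "nbrs r \<inter> set (y # u # us @ rev as) = {y, x}"
        unfolding rv[symmetric] using vs by (auto simp: x_def y_def)
      show "x = last (u # us @ rev as)" using hd_vs \<open>as \<noteq> []\<close> by simp
    qed
    moreover have "\<phi> u = \<phi> w"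
    proof (rule chordless_cycle[OF h, of y u "us @ rev ps" w])
      have "successively adj (qs @ bs)"
        using vs(1) qs(2) qs(1) unfolding vs_eq
        by (auto simp: successively_append_iff successively_Cons ps)
      then show "successively adj (y # u # us @ rev ps)"
        unfolding cs[symmetric] by (simp only: successively_adj_rev)
      have "set bs \<inter> set qs = {}"
        using vs(2) ps_vs by (auto simp: vs_eq ps)
      then show "distinct (y # u # us @ rev ps)"
        unfolding cs[symmetric] using vs(2) qs(3) by (auto simp: vs_eq)
      show "set (y # u # us @ rev ps) \<subseteq> S - {r}"
        unfolding cs[symmetric] using vs(3) qs(4) by (auto simp: vs_eq)
      have xbs: "x \<notin> set bs" using vs(2) \<open>as \<noteq> []\<close> vs_eq by (cases as) (auto simp: x_def)
      have "x \<notin> set qs" using ps_vs q(2) xy(4) by (auto simp: ps x_def)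
      moreover have "nbrs r \<inter> set qs \<subseteq> {x, y, w}"
        using qs(8) unfolding x_def[symmetric] y_def[symmetric] by (auto simp: ps qs')
      moreover have "nbrs r \<inter> set bs \<subseteq> {x, y}"
        using vs(5) unfolding x_def[symmetric] y_def[symmetric] by (auto simp: vs_eq)
      ultimately have "nbrs r \<inter> set (qs @ bs) \<subseteq> {y, w}"
        using xbs by auto
      moreover have "y \<in> set bs" "w \<in> set qs" using bs qs(1) by (auto simp: w_def)
      ultimately show "nbrs r \<inter> set (y # u # us @ rev ps) = {y, w}"
        unfolding cs[symmetric] using xy by auto
      show "w = last (u # us @ rev ps)" by (simp add: qs')
    qed
    ultimately show False using hole_inj[OF h xy(1,3)] w by metis
  qed
qed

text \<open>
  Two nonadjacent neighbors of \<open>r\<close> are joined by a path that avoids \<open>r\<close>. On a shortest such path, over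
  all nonadjacent pairs, no interior vertex is a neighbor of \<open>r\<close>, by \<open>diamond\<close>. As the degree is at least 3,
  there is a third neighbor, and a shortest path from there to the first path contradicts
  \<open>no_attached_path\<close>.
\<close>

lemma nbrs_clique:
  assumes r: "r \<in> S" "linked adj (S - {r})" and xy: "x \<in> nbrs r" "y \<in> nbrs r" "x \<noteq> y"
  shows "adj x y"
proof (rule ccontr)
  assume nadj: "\<not> adj x y"
  \<comment> \<open>Walks in \<open>S - {r}\<close> between two nonadjacent neighbors of \<open>r\<close>.\<close>
  define P where "P vs \<longleftrightarrow> vs \<noteq> [] \<and> set vs \<subseteq> S - {r} \<and> successively adj vs \<and>
    hd vs \<in> nbrs r \<and> last vs \<in> nbrs r \<and> hd vs \<noteq> last vs \<and> \<not> adj (hd vs) (last vs)" for vs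
  have nbr_S: "nbrs r \<subseteq> S - {r}" using adj_irrefl by (auto simp: nbrs_def)
  obtain ws where "P ws" using linked_walk[OF r(2), of x y] xy nbr_S nadj unfolding P_def by blast
  then obtain vs where vs: "P vs" and least: "\<And>us. P us \<Longrightarrow> length vs \<le> length us"
    using ex_has_least_nat[of P ws length] by blast
  have dist: "distinct vs"
  proof (rule ccontr)
    assume "\<not> distinct vs"
    then obtain us where "us \<noteq> []" "length us < length vs" "set us \<subseteq> set vs" "successively adj us"
      "hd us = hd vs" "last us = last vs"
      using shortcut_walk[of vs adj] vs unfolding P_def by blast
    then show False using least[of us] vs unfolding P_def by auto
  qed
  have int: "nbrs r \<inter> set vs = {hd vs, last vs}"
  proof (rule ccontr)
    assume "nbrs r \<inter> set vs \<noteq> {hd vs, last vs}"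
    then obtain z where z: "z \<in> nbrs r" "z \<in> set vs" "z \<noteq> hd vs" "z \<noteq> last vs"
      using vs unfolding P_def by auto
    then obtain us zs where eq: "vs = us @ z # zs" by (meson split_list)
    have ne: "us \<noteq> []" "zs \<noteq> []" using z eq by auto
    have hl: "hd vs = hd us" "last vs = last zs" using eq ne by auto
    have "adj (hd vs) z"
    proof (rule ccontr)
      assume "\<not> adj (hd vs) z"
      then have "P (us @ [z])"
        using vs z ne unfolding P_def hl unfolding eq by (auto simp: successively_append_iff)
      then show False using least[of "us @ [z]"] ne eq by auto
    qed
    moreover have "adj (last vs) z"
    proof (rule ccontr)
      assume "\<not> adj (last vs) z"
      then have "P (z # zs)"
        using vs z ne adj_sym unfolding P_def hl unfolding eq by (auto simp: successively_append_iff)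
      then show False using least[of "z # zs"] ne eq by auto
    qed
    moreover have "adj (hd vs) r" "adj (last vs) r" "adj r z" "hd vs \<in> S" "last vs \<in> S" "z \<in> S"
      using vs z adj_sym by (auto simp: P_def nbrs_def)
    ultimately have "adj (hd vs) (last vs)"
      using diamond[of r z "hd vs" "last vs"] r(1) vs unfolding P_def by blast
    then show False using vs unfolding P_def by blast
  qed
  have len: "3 \<le> length vs"
  proof (rule ccontr)
    assume "\<not> 3 \<le> length vs"
    moreover have "length vs \<noteq> 0" using vs unfolding P_def by simp
    ultimately have "length vs = 1 \<or> length vs = 2" by linarith
    then obtain a b where "vs = [a] \<or> vs = [a, b]" by (auto simp: length_Suc_conv numeral_2_eq_2)
    then show False using vs unfolding P_def by auto
  qed
  have "card (nbrs r) = d" using degree r(1) by (simp add: nbrs_def)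
  then have "\<not> nbrs r \<subseteq> {hd vs, last vs}"
    using three_le_d card_mono[of "{hd vs, last vs}" "nbrs r"] card_insert_le_m1[of 2 "{last vs}" "hd vs"]
    by auto
  then obtain w where w: "w \<in> nbrs r" "w \<noteq> hd vs" "w \<noteq> last vs" by blast
  \<comment> \<open>Walks in \<open>S - {r}\<close> from a third neighbor of \<open>r\<close> to \<open>vs\<close>.\<close>
  define Q where "Q qs \<longleftrightarrow> qs \<noteq> [] \<and> set qs \<subseteq> S - {r} \<and> successively adj qs \<and>
    hd qs \<in> nbrs r - {hd vs, last vs} \<and> last qs \<in> set vs" for qs
  obtain ws where "Q ws"
    using linked_walk[OF r(2), of w "hd vs"] w nbr_S vs unfolding P_def Q_def by fastforce
  then obtain qs where qs: "Q qs" and qleast: "\<And>us. Q us \<Longrightarrow> length qs \<le> length us"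
    using ex_has_least_nat[of Q ws length] by blast
  have qdist: "distinct qs"
  proof (rule ccontr)
    assume "\<not> distinct qs"
    then obtain us where "us \<noteq> []" "length us < length qs" "set us \<subseteq> set qs" "successively adj us"
      "hd us = hd qs" "last us = last qs"
      using shortcut_walk[of qs adj] qs unfolding Q_def by blast
    then show False using qleast[of us] qs unfolding Q_def by auto
  qed
  have qtl: "nbrs r \<inter> set (tl qs) \<subseteq> {hd vs, last vs}"
  proof (rule ccontr)
    assume "\<not> nbrs r \<inter> set (tl qs) \<subseteq> {hd vs, last vs}"
    then obtain z where z: "z \<in> nbrs r - {hd vs, last vs}" "z \<in> set (tl qs)" by blast
    then obtain us zs where "tl qs = us @ z # zs" by (meson split_list)
    then have "qs = (hd qs # us) @ z # zs" using qs unfolding Q_def by (metis append_Cons list.collapse)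
    then obtain us' where eq: "qs = us' @ z # zs" and "us' \<noteq> []" by blast
    have "set (z # zs) \<subseteq> set qs" "successively adj (z # zs)" "last (z # zs) = last qs"
      using qs unfolding Q_def eq by (auto simp: successively_append_iff)
    then have "Q (z # zs)" using qs z unfolding Q_def by auto
    then show False using qleast[of "z # zs"] \<open>us' \<noteq> []\<close> by (simp add: eq)
  qed
  have qbl: "set (butlast qs) \<inter> set vs = {}"
  proof (rule ccontr)
    assume "set (butlast qs) \<inter> set vs \<noteq> {}"
    then obtain z where z: "z \<in> set vs" "z \<in> set (butlast qs)" by blast
    then obtain us zs where "butlast qs = us @ z # zs" by (meson split_list)
    then have "qs = us @ z # (zs @ [last qs])"
      using qs unfolding Q_def by (metis append.assoc append_Cons append_butlast_last_id)
    then obtain zs' where eq: "qs = us @ z # zs'" and "zs' \<noteq> []" by blast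
    have "set (us @ [z]) \<subseteq> set qs" "successively adj (us @ [z])" "hd (us @ [z]) = hd qs"
      using qs unfolding Q_def eq by (auto simp: successively_append_iff hd_append)
    then have "Q (us @ [z])" using qs z unfolding Q_def by auto
    then show False using qleast[of "us @ [z]"] \<open>zs' \<noteq> []\<close> by (simp add: eq)
  qed
  obtain \<phi> where h: "hole r \<phi>" using hole_exists r(1) by blast
  have hq: "hd qs \<notin> set vs" using qs int unfolding Q_def by blast
  show False
  proof (cases "last qs = hd vs")
    case False
    then show False
      using no_attached_path[OF h, of vs qs] vs dist int len qs qdist qtl qbl hq unfolding P_def Q_def by blast
  next
    case True
    have "vs \<noteq> []" using vs unfolding P_def by blast
    then have hl: "hd (rev vs) = last vs" "last (rev vs) = hd vs" by (auto simp: hd_rev last_rev)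
    have "last qs \<noteq> last vs" using True vs unfolding P_def by simp
    moreover have "successively adj (rev vs)" using vs unfolding P_def by (simp only: successively_adj_rev)
    moreover have "nbrs r \<inter> set (rev vs) = {last vs, hd vs}" using int by auto
    ultimately show False
      using no_attached_path[OF h, of "rev vs" qs] vs dist len qs qdist qtl qbl hq
      unfolding P_def Q_def hl by (simp add: insert_commute)
  qed
qed

text \<open>
  For a vertex \<open>r\<close> that is no cut vertex, \<open>r\<close> and its neighbors form a clique, which exhausts all degrees.
  The lists agree since moving the hole from \<open>r\<close> to a neighbor does not change the set of colors that are in use.
\<close>

theorem complete_with_equal_lists:
  shows "card S = Suc d" and "\<forall>u\<in>S. \<forall>v\<in>S. u \<noteq> v \<longrightarrow> adj u v" and "\<forall>u\<in>S. \<forall>v\<in>S. \<Lambda> u = \<Lambda> v"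
proof -
  have "S \<noteq> {}" using uncolorable by (auto simp: proper_coloring_def)
  then obtain x where x: "x \<in> S" by blast
  have "{w \<in> S. adj x w} \<noteq> {}"
  proof
    assume "{w \<in> S. adj x w} = {}"
    then have "d = 0" using degree[OF x] by (metis card.empty)
    then show False using three_le_d by simp
  qed
  then obtain y where "y \<in> S" "x \<noteq> y" using adj_irrefl by blast
  then obtain r where r: "r \<in> S" "linked adj (S - {r})"
    using linked_remove_vertex[OF linked_S finite_S adj_sym x] by blast
  define T where "T = insert r (nbrs r)"
  have fin: "finite (nbrs v)" for v using finite_S by (simp add: nbrs_def)
  have T: "finite T" "T \<subseteq> S" using fin r(1) by (auto simp: T_def nbrs_def)
  have "r \<notin> nbrs r" using adj_irrefl by (simp add: nbrs_def)
  then have cardT: "card T = Suc d" using fin degree[OF r(1)] by (simp add: T_def nbrs_def)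
  have cl: "adj u v" if "u \<in> T" "v \<in> T" "u \<noteq> v" for u v
    using that nbrs_clique[OF r] adj_sym unfolding T_def nbrs_def by blast
  have closed: "nbrs v = T - {v}" if "v \<in> T" for v
  proof -
    have "T - {v} \<subseteq> nbrs v" using cl that T(2) by (auto simp: nbrs_def)
    moreover have "card (nbrs v) = card (T - {v})"
      using degree that T cardT by (auto simp: nbrs_def)
    ultimately show ?thesis using fin by (metis card_subset_eq)
  qed
  have "T = S"
  proof (rule ccontr)
    assume "T \<noteq> S"
    then have "T \<subset> S" "T \<noteq> {}" using T by (auto simp: T_def)
    then obtain v w where "v \<in> T" "w \<in> S - T" "adj v w" by (rule linked_boundary[OF linked_S])
    then show False using closed[of v] by (auto simp: nbrs_def)
  qed
  then show "card S = Suc d" and "\<forall>u\<in>S. \<forall>v\<in>S. u \<noteq> v \<longrightarrow> adj u v" using cardT cl by auto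
  have eq: "\<Lambda> v = \<Lambda> r" if v: "v \<in> nbrs r" for v
  proof -
    obtain \<phi> where h: "hole r \<phi>" using hole_exists r(1) by blast
    have "\<Lambda> v = (\<phi>(r := \<phi> v)) ` nbrs v"
      using hole_bij[OF hole_step[OF h v]] by (simp add: bij_betw_def)
    also have "nbrs v = insert r (nbrs r - {v})" using closed[of v] v \<open>r \<notin> nbrs r\<close> by (auto simp: T_def)
    also have "(\<phi>(r := \<phi> v)) ` insert r (nbrs r - {v}) = \<phi> ` nbrs r" using v \<open>r \<notin> nbrs r\<close> by (auto simp: image_def)
    also have "\<dots> = \<Lambda> r" using hole_bij[OF h] by (simp add: bij_betw_def)
    finally show ?thesis .
  qed
  then have "\<Lambda> v = \<Lambda> r" if "v \<in> S" for v
  proof -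
    have "v = r \<or> v \<in> nbrs r" using that \<open>T = S\<close>[unfolded T_def] by blast
    then show ?thesis
    proof
      assume "v \<in> nbrs r"
      then show ?thesis by (rule eq)
    qed (rule arg_cong[of v r])
  qed
  then show "\<forall>u\<in>S. \<forall>v\<in>S. \<Lambda> u = \<Lambda> v" by metis
qed

end

section \<open>Choosing from lists of size three\<close>

lemma rare_value_exists:
  assumes "finite N" "finite L" "card N < k * card L"
  shows "\<exists>a\<in>L. card {w \<in> N. f w = a} < k"
proof (rule ccontr)
  assume "\<not> ?thesis"
  then have "(\<Sum>a\<in>L. k) \<le> (\<Sum>a\<in>L. card {w \<in> N. f w = a})" by (intro sum_mono) (auto simp: not_less)
  also have "\<dots> = card (\<Union>a\<in>L. {w \<in> N. f w = a})"
    using assms(1,2) by (intro card_UN_disjoint[symmetric]) auto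
  also have "\<dots> \<le> card N" using assms(1) by (intro card_mono) auto
  finally show False using assms(3) by (simp add: mult.commute)
qed

definition neighbors_in :: "('v \<times> 'v) set \<Rightarrow> 'v set \<Rightarrow> 'v \<Rightarrow> 'v set" where
  "neighbors_in E S v = {w \<in> S. (v, w) \<in> E \<or> (w, v) \<in> E}"

text \<open>
  Here \<open>L\<close> lists the candidates for the classes, which will be pairs of colors.
\<close>

definition choosable :: "('v \<times> 'v) set \<Rightarrow> ('v \<Rightarrow> 'q set) \<Rightarrow> 'v set \<Rightarrow> bool" where
  "choosable E L S \<longleftrightarrow> (\<exists>q. (\<forall>v\<in>S. q v \<in> L v) \<and> stabilizable E S q)"

lemma choosable_insert:
  assumes q: "\<forall>u\<in>S. q u \<in> L u" "a \<in> L v" "v \<notin> S"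
    and st: "stabilizable E (insert v S) (q(v := a))"
  shows "choosable E L (insert v S)"
  unfolding choosable_def using assms by (intro exI[of _ "q(v := a)"]) auto

context
  fixes E :: "('v \<times> 'v) set" and S :: "'v set" and v :: 'v and L :: "'v \<Rightarrow> 'q set"
  assumes fin: "finite S" and v: "v \<notin> S" "(v, v) \<notin> E"
    and L: "finite (L v)" "card (L v) = 3"
    and S: "choosable E L S"
begin

lemma choosable_insert_few_out:
  assumes "card {w \<in> S. (v, w) \<in> E} \<le> 2"
  shows "choosable E L (insert v S)"
proof -
  obtain q where q: "\<forall>u\<in>S. q u \<in> L u" "stabilizable E S q" using S unfolding choosable_def by blast
  obtain a where a: "a \<in> L v" "card {w \<in> {w \<in> S. (v, w) \<in> E}. q w = a} < 1"
    using rare_value_exists[of "{w \<in> S. (v, w) \<in> E}" "L v" 1 q] fin L assms by auto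
  then have "{w \<in> {w \<in> S. (v, w) \<in> E}. q w = a} = {}" using fin by simp
  then have none: "q w \<noteq> a" if "w \<in> S" "(v, w) \<in> E" for w using that by blast
  have "stabilizable E S (q(v := a))" by (rule stabilizable_cong[OF q(2)]) (use v in auto)
  then have "stabilizable E (insert v S) (q(v := a))"
    by (rule stabilizable_insert_no_out) (use fin v none in auto)
  then show ?thesis using choosable_insert[OF q(1) a(1) v(1)] by blast
qed

lemma choosable_insert_few_in:
  assumes "card {w \<in> S. (w, v) \<in> E} \<le> 2"
  shows "choosable E L (insert v S)"
proof -
  obtain q where q: "\<forall>u\<in>S. q u \<in> L u" "stabilizable E S q" using S unfolding choosable_def by blast
  obtain a where a: "a \<in> L v" "card {w \<in> {w \<in> S. (w, v) \<in> E}. q w = a} < 1"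
    using rare_value_exists[of "{w \<in> S. (w, v) \<in> E}" "L v" 1 q] fin L assms by auto
  then have "{w \<in> {w \<in> S. (w, v) \<in> E}. q w = a} = {}" using fin by simp
  then have none: "q w \<noteq> a" if "w \<in> S" "(w, v) \<in> E" for w using that by blast
  have "stabilizable E S (q(v := a))" by (rule stabilizable_cong[OF q(2)]) (use v in auto)
  then have "stabilizable E (insert v S) (q(v := a))"
    by (rule stabilizable_insert_no_in) (use fin v none in auto)
  then show ?thesis using choosable_insert[OF q(1) a(1) v(1)] by blast
qed

text \<open>
  Five neighbors cannot use each of three values twice.
\<close>

lemma choosable_insert_few_neighbors:
  assumes "card (neighbors_in E S v) \<le> 5"
  shows "choosable E L (insert v S)"
proof -
  obtain q where q: "\<forall>u\<in>S. q u \<in> L u" "stabilizable E S q" using S unfolding choosable_def by blast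
  have finN: "finite (neighbors_in E S v)" using fin by (simp add: neighbors_in_def)
  obtain a where a: "a \<in> L v" "card {w \<in> neighbors_in E S v. q w = a} < 2"
    using rare_value_exists[of "neighbors_in E S v" "L v" 2 q] finN L assms by auto
  have "finite {w \<in> neighbors_in E S v. q w = a}" "card {w \<in> neighbors_in E S v. q w = a} \<le> Suc 0"
    using a(2) finN by auto
  then have "\<forall>w\<in>{w \<in> neighbors_in E S v. q w = a}. \<forall>w'\<in>{w \<in> neighbors_in E S v. q w = a}. w = w'"
    by (simp only: card_le_Suc0_iff_eq)
  then have "\<exists>x. \<forall>w. w \<in> neighbors_in E S v \<longrightarrow> q w = a \<longrightarrow> w = x"
    by (cases "\<exists>x. x \<in> neighbors_in E S v \<and> q x = a") auto
  then obtain x where x: "\<And>w. w \<in> neighbors_in E S v \<Longrightarrow> q w = a \<Longrightarrow> w = x" by blast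
  have "stabilizable E S (q(v := a))" by (rule stabilizable_cong[OF q(2)]) (use v in auto)
  then have "stabilizable E (insert v S) (q(v := a))"
    by (rule stabilizable_insert_one_neighbor[where x = x]) (use fin v x in \<open>auto simp: neighbors_in_def split: if_splits\<close>)
  then show ?thesis using choosable_insert[OF q(1) a(1) v(1)] by blast
qed

end

lemma choosable_Un:
  assumes AB: "choosable E L A" "choosable E L B" "finite A" "finite B" "A \<inter> B = {}"
    and sep: "\<And>u w. u \<in> A \<Longrightarrow> w \<in> B \<Longrightarrow> (u, w) \<notin> E \<and> (w, u) \<notin> E"
  shows "choosable E L (A \<union> B)"
proof -
  obtain q q' where q: "\<forall>u\<in>A. q u \<in> L u" "stabilizable E A q" "\<forall>u\<in>B. q' u \<in> L u" "stabilizable E B q'"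
    using AB unfolding choosable_def by blast
  define r where "r v = (if v \<in> A then q v else q' v)" for v
  have "stabilizable E A r" by (rule stabilizable_cong[OF q(2)]) (simp add: r_def)
  moreover have "stabilizable E B r" by (rule stabilizable_cong[OF q(4)]) (use AB(5) in \<open>auto simp: r_def\<close>)
  ultimately have "stabilizable E (A \<union> B) r" using AB sep by (intro stabilizable_Un) auto
  moreover have "\<forall>v\<in>A \<union> B. r v \<in> L v" using q by (auto simp: r_def)
  ultimately show ?thesis unfolding choosable_def by blast
qed

text \<open>
  The bits are a bipartition of every class.
\<close>

lemma choosable_of_proper_coloring:
  assumes "finite S" "proper_coloring (\<lambda>u v. (u, v) \<in> E \<or> (v, u) \<in> E) (\<lambda>v. L v \<times> (UNIV :: bool set)) S \<phi>"
  shows "choosable E L S"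
proof -
  have "stabilizable E S (fst \<circ> \<phi>)"
  proof (rule stabilizable_bipartite[OF assms(1), where bit = "snd \<circ> \<phi>"])
    fix v w assume "v \<in> S" "w \<in> S" "(v, w) \<in> E" "(fst \<circ> \<phi>) v = (fst \<circ> \<phi>) w"
    moreover from this have "\<phi> v \<noteq> \<phi> w"
      using assms(2) unfolding proper_coloring_def by blast
    ultimately show "(snd \<circ> \<phi>) v \<noteq> (snd \<circ> \<phi>) w"
      by (simp add: prod_eq_iff)
  qed
  moreover have "\<forall>v\<in>S. (fst \<circ> \<phi>) v \<in> L v"
    using assms(2) unfolding proper_coloring_def by (auto simp: mem_Times_iff)
  ultimately show ?thesis unfolding choosable_def by blast
qed

locale critical_set =
  fixes E :: "('v \<times> 'v) set" and L :: "'v \<Rightarrow> 'q set" and S :: "'v set"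
  assumes fin: "finite S"
    and irrefl: "(v, v) \<notin> E"
    and L: "v \<in> S \<Longrightarrow> finite (L v)" "v \<in> S \<Longrightarrow> card (L v) = 3"
    and not_choosable: "\<not> choosable E L S"
    and subset_choosable: "T \<subset> S \<Longrightarrow> choosable E L T"
begin

lemma
  assumes v: "v \<in> S"
  shows many_out: "3 \<le> card {w \<in> S. (v, w) \<in> E}"
    and many_in: "3 \<le> card {w \<in> S. (w, v) \<in> E}"
    and many_neighbors: "6 \<le> card (neighbors_in E S v)"
proof -
  have ins: "insert v (S - {v}) = S" using v by blast
  have S': "finite (S - {v})" "v \<notin> S - {v}" "choosable E L (S - {v})"
    using fin subset_choosable[of "S - {v}"] v by auto
  have eq: "{w \<in> S. (v, w) \<in> E} = {w \<in> S - {v}. (v, w) \<in> E}" "{w \<in> S. (w, v) \<in> E} = {w \<in> S - {v}. (w, v) \<in> E}"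
    "neighbors_in E S v = neighbors_in E (S - {v}) v"
    using irrefl unfolding neighbors_in_def by blast+
  note * = S'(1,2) irrefl L[OF v] S'(3)
  show "3 \<le> card {w \<in> S. (v, w) \<in> E}"
    using choosable_insert_few_out[OF *] not_choosable unfolding ins eq(1) by fastforce
  show "3 \<le> card {w \<in> S. (w, v) \<in> E}"
    using choosable_insert_few_in[OF *] not_choosable unfolding ins eq(2) by fastforce
  show "6 \<le> card (neighbors_in E S v)"
    using choosable_insert_few_neighbors[OF *] not_choosable unfolding ins eq(3) by fastforce
qed

lemma linked_underlying: "linked (\<lambda>u v. (u, v) \<in> E \<or> (v, u) \<in> E) S"
  unfolding linked_def
proof (intro allI impI, rule ccontr)
  fix X assume X: "X \<subset> S" "X \<noteq> {}" and no: "\<not> (\<exists>v\<in>X. \<exists>w\<in>S - X. (v, w) \<in> E \<or> (w, v) \<in> E)"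
  have "S - X \<subset> S" using X by blast
  then have "choosable E L (X \<union> (S - X))"
    using X no subset_choosable fin by (intro choosable_Un) (auto intro: finite_subset)
  moreover have "X \<union> (S - X) = S" using X by blast
  ultimately show False using not_choosable by simp
qed

context
  assumes six: "\<And>v. v \<in> S \<Longrightarrow> card (neighbors_in E S v) \<le> 6"
begin

lemma tight: "tight_lists (\<lambda>u v. (u, v) \<in> E \<or> (v, u) \<in> E) S (\<lambda>v. L v \<times> (UNIV :: bool set)) 6"
proof
  fix v assume v: "v \<in> S"
  show "card {w \<in> S. (v, w) \<in> E \<or> (w, v) \<in> E} = 6"
    using six[OF v] many_neighbors[OF v] by (simp add: neighbors_in_def)
  show "card (L v \<times> (UNIV :: bool set)) = 6" using L[OF v] by (simp add: card_cartesian_product)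
next
  fix \<phi> show "\<not> proper_coloring (\<lambda>u v. (u, v) \<in> E \<or> (v, u) \<in> E) (\<lambda>v. L v \<times> (UNIV :: bool set)) S \<phi>"
    using choosable_of_proper_coloring[OF fin] not_choosable by blast
qed (use fin irrefl linked_underlying in auto)

lemma card_seven: "card S = 7"
  using tight_lists.complete_with_equal_lists(1)[OF tight] by simp

text \<open>
  Suppose that \<open>r\<close> has no arcs to \<open>x\<close> and \<open>y\<close>. As all lists are equal, \<open>x\<close> and \<open>y\<close> can be put into one class and
  the other four vertices, in pairs, into the two other classes. The vertex \<open>r\<close> then joins \<open>x\<close> and \<open>y\<close>, where it has
  no out-neighbor.
\<close>

lemma five_out:
  assumes r: "r \<in> S"
  shows "5 \<le> card {w \<in> S. (r, w) \<in> E}"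
proof (rule ccontr)
  assume few: "\<not> 5 \<le> card {w \<in> S. (r, w) \<in> E}"
  \<comment> \<open>As \<open>S\<close> is complete, these are the vertices that have an arc to \<open>r\<close> only.\<close>
  define M where "M = {w \<in> S - {r}. (r, w) \<notin> E}"
  have "S - {r} = {w \<in> S. (r, w) \<in> E} \<union> M" using irrefl by (auto simp: M_def)
  moreover have "card (S - {r}) = 6" using card_seven r by simp
  ultimately have "6 \<le> card {w \<in> S. (r, w) \<in> E} + card M" by (metis card_Un_le)
  then have "\<not> card M \<le> Suc 0" using few by linarith
  moreover have "finite M" using fin by (simp add: M_def)
  ultimately obtain x y where xy: "x \<in> M" "y \<in> M" "x \<noteq> y"
    unfolding card_le_Suc0_iff_eq[OF \<open>finite M\<close>] by blast
  obtain a where a: "a \<in> L r" using L(2)[OF r] by force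
  define R where "R = S - {r, x, y}"
  have "R = S - {r} - {x} - {y}" by (auto simp: R_def)
  then have "card R = 4" using \<open>card (S - {r}) = 6\<close> xy by (simp add: M_def)
  moreover have "card ((L r - {a}) \<times> (UNIV :: bool set)) = 4"
    using L[OF r] a by (simp add: card_cartesian_product)
  moreover have "finite R" "finite ((L r - {a}) \<times> (UNIV :: bool set))" using fin L(1)[OF r] by (auto simp: R_def)
  ultimately obtain g where g: "bij_betw g R ((L r - {a}) \<times> (UNIV :: bool set))"
    using finite_same_card_bij by metis
  define \<phi> where "\<phi> v = (if v = x then (a, True) else if v = y then (a, False) else g v)" for v
  have gR: "fst (g v) \<in> L r" "fst (g v) \<noteq> a" if "v \<in> R" for v
    using bij_betwE[OF g] that by (auto simp: mem_Times_iff)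
  have Lr: "L v = L r" if "v \<in> S" for v
  proof -
    have "L v \<times> (UNIV :: bool set) = L r \<times> UNIV"
      using tight_lists.complete_with_equal_lists(3)[OF tight] that r by blast
    then show ?thesis by auto
  qed
  have mem: "v \<in> S - {r} \<Longrightarrow> v = x \<or> v = y \<or> v \<in> R" for v by (auto simp: R_def)
  have inj: "\<phi> v \<noteq> \<phi> w" if "v \<in> S - {r}" "w \<in> S - {r}" "v \<noteq> w" for v w
  proof
    assume eq: "\<phi> v = \<phi> w"
    have nR: "x \<notin> R" "y \<notin> R" by (auto simp: R_def)
    have \<phi>R: "\<phi> u = g u" "g u \<noteq> (a, t)" "(a, t) \<noteq> g u" if "u \<in> R" for u t
      using that nR gR(2)[of u] by (cases "g u"; auto simp: \<phi>_def)+
    have \<phi>xy: "\<phi> x = (a, True)" "\<phi> y = (a, False)" using xy(3) by (auto simp: \<phi>_def)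
    have gi: "v \<in> R \<Longrightarrow> w \<in> R \<Longrightarrow> g v = g w \<Longrightarrow> v = w" using g by (auto simp: bij_betw_def dest: inj_onD)
    from mem[OF that(1)] mem[OF that(2)] show False
      using eq that(3) gi \<phi>R(1)[of v] \<phi>R(1)[of w] \<phi>R(2,3)[of v] \<phi>R(2,3)[of w] \<phi>xy by auto
  qed
  define q where "q = (fst \<circ> \<phi>)(r := a)"
  have q: "q v = fst (\<phi> v)" if "v \<in> S - {r}" for v using that by (simp add: q_def)
  have "stabilizable E (S - {r}) q"
  proof (rule stabilizable_bipartite[where bit = "snd \<circ> \<phi>"])
    fix v w assume vw: "v \<in> S - {r}" "w \<in> S - {r}" "(v, w) \<in> E" "q v = q w"
    then have "v \<noteq> w" using irrefl by blast
    then have "\<phi> v \<noteq> \<phi> w" using inj vw by blast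
    then show "(snd \<circ> \<phi>) v \<noteq> (snd \<circ> \<phi>) w" using vw q by (auto simp: prod_eq_iff)
  qed (use fin in auto)
  then have "stabilizable E (insert r (S - {r})) q"
  proof (rule stabilizable_insert_no_out)
    fix w assume w: "w \<in> S - {r}" "(r, w) \<in> E"
    then have "w \<in> R" using xy by (auto simp: R_def M_def)
    then have "fst (\<phi> w) \<noteq> a" using gR(2)[of w] by (auto simp: \<phi>_def R_def)
    then show "q w \<noteq> q r" using w q by (simp add: q_def)
  qed (use fin irrefl in auto)
  moreover have "insert r (S - {r}) = S" using r by blast
  moreover have "q v \<in> L v" if "v \<in> S" for v
    using that a gR(1)[of v] mem[of v] Lr by (auto simp: q_def \<phi>_def)
  ultimately have "choosable E L S" unfolding choosable_def by auto
  then show False using not_choosable by blast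
qed

end

end

lemma critical_set_exists:
  assumes "finite V" "\<not> choosable E L V" "\<And>v. (v, v) \<notin> E"
    and "\<And>v. v \<in> V \<Longrightarrow> finite (L v)" "\<And>v. v \<in> V \<Longrightarrow> card (L v) = 3"
  shows "\<exists>S\<subseteq>V. critical_set E L S"
proof -
  define F where "F = {S. S \<subseteq> V \<and> \<not> choosable E L S}"
  have "finite F" "V \<in> F" using assms(1,2) by (auto simp: F_def)
  then obtain S where S: "S \<in> F" "\<And>T. T \<in> F \<Longrightarrow> T \<subseteq> S \<Longrightarrow> S = T"
    using finite_has_minimal[of F] by blast
  have "critical_set E L S"
  proof
    fix T assume T: "T \<subset> S"
    show "choosable E L T" using S(1) S(2)[of T] T unfolding F_def by blast
  qed (use S(1) assms in \<open>auto simp: F_def intro: finite_subset\<close>)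
  then show ?thesis using S(1) by (auto simp: F_def)
qed

lemma sum_out_eq_sum_in:
  assumes "finite S"
  shows "(\<Sum>v\<in>S. card {w \<in> S. (v, w) \<in> E}) = (\<Sum>v\<in>S. card {w \<in> S. (w, v) \<in> E})"
proof -
  have c: "card {w \<in> S. P w} = (\<Sum>w\<in>S. of_bool (P w))" for P
    using assms by (simp add: Int_def)
  show ?thesis unfolding c by (rule sum.swap)
qed

text \<open>
  In a critical set all out-degrees are 3 and all in-degrees at least 3, hence equal to 3 by double
  counting. So there are at most 6 neighbors, and \<open>five_out\<close> is contradicted.
\<close>

lemma choosable_of_out_degree_le_3:
  assumes fin: "finite V" and irrefl: "\<And>v. (v, v) \<notin> E"
    and L: "\<And>v. v \<in> V \<Longrightarrow> finite (L v)" "\<And>v. v \<in> V \<Longrightarrow> card (L v) = 3"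
    and deg: "\<And>v. v \<in> V \<Longrightarrow> 3 \<le> card {w \<in> V. (w, v) \<in> E} \<Longrightarrow> card {w \<in> V. (v, w) \<in> E} \<le> 3"
  shows "choosable E L V"
proof (rule ccontr)
  assume not: "\<not> choosable E L V"
  obtain S where SV: "S \<subseteq> V" and S: "critical_set E L S"
    using critical_set_exists[OF fin not irrefl L] by blast
  interpret critical_set E L S by fact
  have out: "card {w \<in> S. (v, w) \<in> E} = 3" if v: "v \<in> S" for v
  proof -
    have sub: "card {w \<in> S. (v, w) \<in> E} \<le> card {w \<in> V. (v, w) \<in> E}"
      "card {w \<in> S. (w, v) \<in> E} \<le> card {w \<in> V. (w, v) \<in> E}"
      using SV assms(1) by (auto intro!: card_mono)
    then have "card {w \<in> V. (v, w) \<in> E} \<le> 3" using deg[of v] many_in[OF v] v SV by auto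
    then show ?thesis using sub many_out[OF v] by linarith
  qed
  have "(\<Sum>v\<in>S. card {w \<in> S. (w, v) \<in> E}) = (\<Sum>v\<in>S. 3)"
    using sum_out_eq_sum_in[of S E] out fin by simp
  then have inn: "card {w \<in> S. (w, v) \<in> E} = 3" if "v \<in> S" for v
    using sum_mono_inv[of "\<lambda>_. 3" S "\<lambda>v. card {w \<in> S. (w, v) \<in> E}" v] many_in that critical_set.fin[OF S] by auto
  have "card (neighbors_in E S v) \<le> 6" if v: "v \<in> S" for v
  proof -
    have "neighbors_in E S v = {w \<in> S. (v, w) \<in> E} \<union> {w \<in> S. (w, v) \<in> E}" by (auto simp: neighbors_in_def)
    then show ?thesis using card_Un_le[of "{w \<in> S. (v, w) \<in> E}" "{w \<in> S. (w, v) \<in> E}"] out[OF v] inn[OF v] by simp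
  qed
  moreover obtain v where "v \<in> S" using card_seven calculation by force
  ultimately show False using five_out[of v] out[of v] by simp
qed

section \<open>From pairs to majority colorings\<close>

text \<open>
  The fixed charge of a color at \<open>v\<close> counts the out-neighbors from other classes whose pair contains it.
  Two different pairs share at most one color, so every out-neighbor is counted for at most one option of
  \<open>v\<close>; the option that is not more expensive than the other meets at most half of them.
\<close>

lemma majority_of_stabilizable_pairs:
  fixes q :: "'v \<Rightarrow> 'c set"
  assumes st: "stabilizable E V q" and fin: "finite V" and pair: "\<And>v. v \<in> V \<Longrightarrow> card (q v) = 2"
  shows "\<exists>c. \<forall>v\<in>V. c v \<in> q v \<and> 2 * card {w \<in> V. (v, w) \<in> E \<and> c w = c v} \<le> card {w \<in> V. (v, w) \<in> E}"
proof -
  have "\<exists>f. \<forall>Q. card Q = 2 \<longrightarrow> Q = {f Q True, f Q False} \<and> f Q True \<noteq> (f Q False :: 'c)"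
  proof -
    have "\<exists>g :: bool \<Rightarrow> 'c. card Q = 2 \<longrightarrow> Q = {g True, g False} \<and> g True \<noteq> g False" for Q :: "'c set"
    proof (cases "card Q = 2")
      case True
      then obtain x y where "Q = {x, y}" "x \<noteq> y" by (meson card_2_iff)
      then show ?thesis by (intro exI[of _ "\<lambda>t. if t then x else y"]) simp
    qed simp
    then show ?thesis by metis
  qed
  then obtain f where f: "\<And>Q. card Q = 2 \<Longrightarrow> Q = {f Q True, f Q False} \<and> f Q True \<noteq> (f Q False :: 'c)"
    by blast
  have f_in: "f (q v) t \<in> q v" if "v \<in> V" for v t
    using f[OF pair[OF that]] by (cases t) auto
  define b where "b v t = card {w \<in> V. (v, w) \<in> E \<and> q w \<noteq> q v \<and> f (q v) t \<in> q w}" for v t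
  obtain s where s: "\<forall>v\<in>V. option_cost E V q b s v (s v) \<le> option_cost E V q b s v (\<not> s v)"
    using st unfolding stabilizable_def by blast
  define c where "c v = f (q v) (s v)" for v
  have "2 * card {w \<in> V. (v, w) \<in> E \<and> c w = c v} \<le> card {w \<in> V. (v, w) \<in> E}" if v: "v \<in> V" for v
  proof -
    define X where "X t = {w \<in> V. (v, w) \<in> E \<and> q w \<noteq> q v \<and> f (q v) t \<in> q w}" for t
    define Y where "Y t = {w \<in> V. (v, w) \<in> E \<and> q w = q v \<and> s w = t}" for t
    have finXY: "finite (X t)" "finite (Y t)" for t using fin by (auto simp: X_def Y_def)
    have "X True \<inter> X False = {}"
    proof (rule ccontr)
      assume "X True \<inter> X False \<noteq> {}"
      then obtain w where w: "w \<in> V" "q w \<noteq> q v" "f (q v) True \<in> q w" "f (q v) False \<in> q w"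
        by (auto simp: X_def)
      then have "q v \<subseteq> q w" using f[OF pair[OF v]] by (metis empty_subsetI insert_subset)
      moreover have "finite (q w)" using pair[OF w(1)] card.infinite by fastforce
      ultimately show False using w(2) pair[OF v] pair[OF w(1)] card_subset_eq by metis
    qed
    then have XX: "X (s v) \<inter> X (\<not> s v) = {}" by (cases "s v") auto
    have YY: "Y (s v) \<inter> Y (\<not> s v) = {}" and XY: "X t \<inter> Y t' = {}" for t t'
      by (auto simp: X_def Y_def)
    have opt: "card (X (s v)) + card (Y (s v)) \<le> card (X (\<not> s v)) + card (Y (\<not> s v))"
      using s v by (auto simp: option_cost_def b_def X_def Y_def)
    have "{w \<in> V. (v, w) \<in> E \<and> c w = c v} \<subseteq> X (s v) \<union> Y (s v)"
    proof
      fix w assume "w \<in> {w \<in> V. (v, w) \<in> E \<and> c w = c v}"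
      then have w: "w \<in> V" "(v, w) \<in> E" "c w = c v" by auto
      show "w \<in> X (s v) \<union> Y (s v)"
      proof (cases "q w = q v")
        case True
        then have "s w = s v" using w(3) f[OF pair[OF v]] unfolding c_def by (metis (full_types))
        then show ?thesis using w True by (simp add: Y_def)
      next
        case False
        then show ?thesis using w f_in[OF w(1), of "s w"] by (simp add: X_def c_def)
      qed
    qed
    then have "card {w \<in> V. (v, w) \<in> E \<and> c w = c v} \<le> card (X (s v)) + card (Y (s v))"
      using finXY by (meson card_Un_le card_mono finite_UnI le_trans)
    moreover have "card (X (s v)) + card (Y (s v)) + (card (X (\<not> s v)) + card (Y (\<not> s v)))
        = card ((X (s v) \<union> Y (s v)) \<union> (X (\<not> s v) \<union> Y (\<not> s v)))"
    proof -
      have "(X (s v) \<union> Y (s v)) \<inter> (X (\<not> s v) \<union> Y (\<not> s v)) = {}"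
        using XX YY XY[of "s v" "\<not> s v"] XY[of "\<not> s v" "s v"] by blast
      then show ?thesis using finXY XY by (simp add: card_Un_disjoint)
    qed
    moreover have "\<dots> \<le> card {w \<in> V. (v, w) \<in> E}"
      using fin by (intro card_mono) (auto simp: X_def Y_def)
    ultimately show ?thesis using opt by linarith
  qed
  moreover have "c v \<in> q v" if "v \<in> V" for v using f_in[OF that] by (simp add: c_def)
  ultimately show ?thesis by blast
qed

text \<open>
  Majority colorings of the subdigraph induced by \<open>V\<close>.
\<close>

definition majority_on :: "('v \<times> 'v) set \<Rightarrow> 'v set \<Rightarrow> ('v \<Rightarrow> 'c) \<Rightarrow> bool" where
  "majority_on E V c \<longleftrightarrow>
     (\<forall>v\<in>V. 2 * card {w \<in> V. (v, w) \<in> E \<and> c w = c v} \<le> card {w \<in> V. (v, w) \<in> E})"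

definition pairs :: "'c set \<Rightarrow> 'c set set" where
  "pairs A = {Q. Q \<subseteq> A \<and> card Q = 2}"

lemma card_pairs: "finite A \<Longrightarrow> card A = 3 \<Longrightarrow> card (pairs A) = 3"
  using n_subsets[of A 2] by (simp add: pairs_def choose_two)

lemma finite_pairs: "finite A \<Longrightarrow> finite (pairs A)"
  by (simp add: pairs_def)

lemma majority_of_choosable:
  assumes "finite V" "choosable E (\<lambda>v. pairs (L v)) V"
  shows "\<exists>c. majority_on E V c \<and> (\<forall>v\<in>V. c v \<in> L v)"
proof -
  obtain q where q: "\<forall>v\<in>V. q v \<in> pairs (L v)" "stabilizable E V q"
    using assms(2) unfolding choosable_def by blast
  then obtain c where "\<forall>v\<in>V. c v \<in> q v \<and> 2 * card {w \<in> V. (v, w) \<in> E \<and> c w = c v} \<le> card {w \<in> V. (v, w) \<in> E}"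
    using majority_of_stabilizable_pairs[OF q(2) assms(1)] by (auto simp: pairs_def)
  then show ?thesis using q(1) unfolding majority_on_def pairs_def by blast
qed

lemma list_coloring_classes_le_3:
  assumes "finite S" "card S \<le> 7" "\<And>v. v \<in> S \<Longrightarrow> finite (L v)" "\<And>v. v \<in> S \<Longrightarrow> card (L v) = 3"
  shows "\<exists>c. (\<forall>v\<in>S. c v \<in> L v) \<and> (\<forall>a. card {w \<in> S. c w = a} \<le> 3)"
  using assms
proof (induction S rule: finite_induct)
  case empty
  then show ?case by simp
next
  case (insert v S)
  then obtain c where c: "\<forall>v\<in>S. c v \<in> L v" "\<forall>a. card {w \<in> S. c w = a} \<le> 3" by auto
  have "card S < 3 * card (L v)" using insert.prems(1,3) insert.hyps by simp
  then obtain a where a: "a \<in> L v" "card {w \<in> S. c w = a} < 3"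
    using rare_value_exists[of S "L v" 3 c] insert by auto
  define c' where "c' = c(v := a)"
  have "card {w \<in> insert v S. c' w = b} \<le> 3" for b
  proof -
    have "{w \<in> S. c' w = b} = {w \<in> S. c w = b}" using insert.hyps by (auto simp: c'_def)
    then show ?thesis
      using card_filter_insert[OF insert.hyps, of "\<lambda>w. c' w = b"] c(2)[rule_format, of b] a(2)
      by (auto simp: c'_def split: if_splits)
  qed
  then show ?case using c(1) a(1) insert.hyps(2) by (intro exI[of _ c']) (auto simp: c'_def)
qed

text \<open>
  A critical set has full degree inside itself, so it is a union of components. It has 7 vertices, each with
  out-degree at least 5; in a coloring with at most three vertices of each color a vertex has at most two
  out-neighbors of its own color. The remaining vertices are colored by induction.
\<close>

lemma majority_of_underlying_degree_le_6:
  assumes "finite V" and irrefl: "\<And>v. (v, v) \<notin> E"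
    and "\<And>v. v \<in> V \<Longrightarrow> finite (L v)" "\<And>v. v \<in> V \<Longrightarrow> card (L v) = 3"
    and "\<And>v. v \<in> V \<Longrightarrow> card (neighbors_in E V v) \<le> 6"
  shows "\<exists>c. majority_on E V c \<and> (\<forall>v\<in>V. c v \<in> L v)"
  using assms(1,3-)
proof (induction V rule: finite_psubset_induct)
  case (psubset V)
  note lists = psubset.prems(1,2) and deg = psubset.prems(3)
  show ?case
  proof (cases "choosable E (\<lambda>v. pairs (L v)) V")
    case True
    then show ?thesis using majority_of_choosable psubset.hyps by blast
  next
    case False
    obtain S where SV: "S \<subseteq> V" and S: "critical_set E (\<lambda>v. pairs (L v)) S"
      using critical_set_exists[OF psubset.hyps False irrefl] lists card_pairs finite_pairs by blast
    interpret critical_set E "\<lambda>v. pairs (L v)" S by fact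
    have sub: "neighbors_in E S v \<subseteq> neighbors_in E V v" for v using SV by (auto simp: neighbors_in_def)
    have finV: "finite (neighbors_in E V v)" for v using psubset.hyps by (simp add: neighbors_in_def)
    have six: "card (neighbors_in E S v) \<le> 6" if "v \<in> S" for v
      using card_mono[OF finV sub[of v]] deg[of v] that SV by auto
    have closed: "neighbors_in E V v = neighbors_in E S v" if "v \<in> S" for v
      using card_seteq[OF finV sub[of v]] deg[of v] many_neighbors[OF that] that SV by force
    have sep: "(v, w) \<notin> E \<and> (w, v) \<notin> E" if "v \<in> S" "w \<in> V - S" for v w
      using closed[OF that(1)] that(2) by (auto simp: neighbors_in_def)
    obtain c where c: "\<forall>v\<in>S. c v \<in> L v" "\<forall>a. card {w \<in> S. c w = a} \<le> 3"
      using list_coloring_classes_le_3[of S L] fin card_seven[OF six] lists SV by auto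
    have "S \<noteq> {}" using card_seven[OF six] by auto
    have "\<exists>c'. majority_on E (V - S) c' \<and> (\<forall>v\<in>V - S. c' v \<in> L v)"
    proof (rule psubset.IH)
      show "V - S \<subset> V" using SV \<open>S \<noteq> {}\<close> by blast
      fix v assume v: "v \<in> V - S"
      then show "finite (L v)" "card (L v) = 3" using lists by auto
      have "neighbors_in E (V - S) v \<subseteq> neighbors_in E V v" by (auto simp: neighbors_in_def)
      then have "card (neighbors_in E (V - S) v) \<le> card (neighbors_in E V v)" by (rule card_mono[OF finV])
      also have "\<dots> \<le> 6" using deg v by blast
      finally show "card (neighbors_in E (V - S) v) \<le> 6" .
    qed
    then obtain c' where c': "majority_on E (V - S) c'" "\<forall>v\<in>V - S. c' v \<in> L v" by blast
    define k where "k v = (if v \<in> S then c v else c' v)" for v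
    have "2 * card {w \<in> V. (v, w) \<in> E \<and> k w = k v} \<le> card {w \<in> V. (v, w) \<in> E}" if v: "v \<in> V" for v
    proof (cases "v \<in> S")
      case True
      have "{w \<in> V. (v, w) \<in> E \<and> k w = k v} \<subseteq> {w \<in> S. c w = c v} - {v}"
        using sep[OF True] True irrefl by (auto simp: k_def)
      then have "card {w \<in> V. (v, w) \<in> E \<and> k w = k v} \<le> card ({w \<in> S. c w = c v} - {v})"
        using fin by (intro card_mono) auto
      also have "\<dots> \<le> 2" using True c(2)[rule_format, of "c v"] fin by simp
      finally have "card {w \<in> V. (v, w) \<in> E \<and> k w = k v} \<le> 2" .
      moreover have "card {w \<in> S. (v, w) \<in> E} \<le> card {w \<in> V. (v, w) \<in> E}"
        using SV psubset.hyps by (intro card_mono) auto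
      ultimately show ?thesis using five_out[OF six True] by linarith
    next
      case False
      have "{w \<in> V. (v, w) \<in> E \<and> k w = k v} = {w \<in> V - S. (v, w) \<in> E \<and> c' w = c' v}"
        "{w \<in> V. (v, w) \<in> E} = {w \<in> V - S. (v, w) \<in> E}"
        using sep v False by (auto simp: k_def)
      then show ?thesis using c'(1) v False unfolding majority_on_def by simp
    qed
    moreover have "\<forall>v\<in>V. k v \<in> L v" using c(1) c'(2) by (simp add: k_def)
    ultimately show ?thesis unfolding majority_on_def by blast
  qed
qed

text \<open>
  At a vertex of out-degree 4 one arc is deleted. At most one of the remaining three out-neighbors then has
  the color of the vertex, thus at most two of all four.
\<close>

lemma majority_of_out_degree_le_4:
  assumes fin: "finite V" and irrefl: "\<And>v. (v, v) \<notin> E"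
    and L: "\<And>v. v \<in> V \<Longrightarrow> finite (L v)" "\<And>v. v \<in> V \<Longrightarrow> card (L v) = 3"
    and deg: "\<And>v. v \<in> V \<Longrightarrow> 3 \<le> card {w \<in> V. (w, v) \<in> E} \<Longrightarrow> card {w \<in> V. (v, w) \<in> E} \<le> 4"
  shows "\<exists>c. majority_on E V c \<and> (\<forall>v\<in>V. c v \<in> L v)"
proof -
  define N where "N v = {w \<in> V. (v, w) \<in> E}" for v
  have finN: "finite (N v)" for v using fin by (simp add: N_def)
  define o' where "o' v = (SOME w. w \<in> N v)" for v
  have o': "o' v \<in> N v" if "card (N v) = 4" for v
  proof -
    have "N v \<noteq> {}" using that by auto
    then show ?thesis unfolding o'_def by (simp add: some_in_eq)
  qed
  define F where "F = {(v, w) \<in> E. \<not> (card (N v) = 4 \<and> w = o' v)}"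
  have outF: "{w \<in> V. (v, w) \<in> F} = (if card (N v) = 4 then N v - {o' v} else N v)" for v
    by (auto simp: F_def N_def)
  have "choosable F (\<lambda>v. pairs (L v)) V"
  proof (rule choosable_of_out_degree_le_3[OF fin])
    fix v assume v: "v \<in> V" "3 \<le> card {w \<in> V. (w, v) \<in> F}"
    have "card {w \<in> V. (w, v) \<in> F} \<le> card {w \<in> V. (w, v) \<in> E}"
      using fin by (intro card_mono) (auto simp: F_def)
    then have "card (N v) \<le> 4" using deg[OF v(1)] v(2) by (simp add: N_def)
    then show "card {w \<in> V. (v, w) \<in> F} \<le> 3" unfolding outF using o' finN by auto
  next
    fix v assume "v \<in> V"
    then show "finite (pairs (L v))" "card (pairs (L v)) = 3" using L finite_pairs card_pairs by blast+
  qed (use irrefl in \<open>auto simp: F_def\<close>)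
  then obtain c where c: "majority_on F V c" "\<forall>v\<in>V. c v \<in> L v" using majority_of_choosable fin by blast
  have "2 * card {w \<in> V. (v, w) \<in> E \<and> c w = c v} \<le> card {w \<in> V. (v, w) \<in> E}" if v: "v \<in> V" for v
  proof -
    have F: "2 * card {w \<in> V. (v, w) \<in> F \<and> c w = c v} \<le> card {w \<in> V. (v, w) \<in> F}"
      using c(1) v by (simp add: majority_on_def)
    show ?thesis
    proof (cases "card (N v) = 4")
      case True
      have "{w \<in> V. (v, w) \<in> E \<and> c w = c v} \<subseteq> insert (o' v) {w \<in> V. (v, w) \<in> F \<and> c w = c v}"
        by (auto simp: F_def)
      then have "card {w \<in> V. (v, w) \<in> E \<and> c w = c v} \<le> card (insert (o' v) {w \<in> V. (v, w) \<in> F \<and> c w = c v})"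
        using fin by (intro card_mono) auto
      also have "\<dots> \<le> Suc (card {w \<in> V. (v, w) \<in> F \<and> c w = c v})" using fin by (simp add: card_insert_if)
      finally show ?thesis using F True o'[OF True] finN unfolding outF by (simp add: N_def[symmetric])
    next
      case False
      then have "{w \<in> V. (v, w) \<in> F \<and> c w = c v} = {w \<in> V. (v, w) \<in> E \<and> c w = c v}" by (auto simp: F_def)
      then show ?thesis using F False unfolding outF by (simp add: N_def)
    qed
  qed
  then show ?thesis using c(2) unfolding majority_on_def by blast
qed


section \<open>The degree conditions\<close>

lemma (in digraph) out_degree_eq_card: "out_degree G v = card {w \<in> verts G. (v, w) \<in> arcs_ends G}"
proof -
  have "inj_on (head G) (out_arcs G v)"
    by (rule inj_onI) (auto simp: no_multi_arcs arc_to_ends_def)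
  moreover have "head G ` out_arcs G v = {w \<in> verts G. (v, w) \<in> arcs_ends G}"
    by (auto simp: arcs_ends_conv)
  ultimately show ?thesis unfolding out_degree_def by (metis card_image)
qed

lemma (in digraph) in_degree_eq_card: "in_degree G v = card {w \<in> verts G. (w, v) \<in> arcs_ends G}"
proof -
  have "inj_on (tail G) (in_arcs G v)"
    by (rule inj_onI) (auto simp: no_multi_arcs arc_to_ends_def)
  moreover have "tail G ` in_arcs G v = {w \<in> verts G. (w, v) \<in> arcs_ends G}"
    by (auto simp: arcs_ends_conv)
  ultimately show ?thesis unfolding in_degree_def by (metis card_image)
qed

lemma (in digraph) underlying_degree_eq_card:
  "out_degree (with_proj (mk_symmetric G)) v = card (neighbors_in (arcs_ends G) (verts G) v)"
proof -
  have "inj_on snd (out_arcs (with_proj (mk_symmetric G)) v)"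
    by (rule inj_onI) (auto simp: prod_eq_iff)
  moreover have "snd ` out_arcs (with_proj (mk_symmetric G)) v = neighbors_in (arcs_ends G) (verts G) v"
    by (auto simp: neighbors_in_def arcs_ends_conv parcs_mk_symmetric out_arcs_def image_iff)
  ultimately show ?thesis unfolding out_degree_def by (metis card_image)
qed

theorem theorem3:
  fixes D :: "('a, 'b) pre_digraph"
  assumes "digraph D"
    and "max_out_degree D \<le> 4 \<or> max_degree_underlying D \<le> 6 \<or> max_degree D \<le> 7"
  shows "majority_choosable TYPE('c) 3 D"
  unfolding majority_choosable_def
proof (intro allI impI)
  interpret digraph D by fact
  fix L :: "'a \<Rightarrow> 'c set"
  assume L: "\<forall>v\<in>verts D. finite (L v) \<longrightarrow> 3 \<le> card (L v)"
  define V where "V = verts D"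
  define E where "E = arcs_ends D"
  have fin: "finite V" by (simp add: V_def)
  have irrefl: "(v, v) \<notin> E" for v unfolding E_def arcs_ends_conv using no_loops by fastforce
  have "\<exists>A. A \<subseteq> L v \<and> finite A \<and> card A = 3" if "v \<in> V" for v
  proof (cases "finite (L v)")
    case True
    then show ?thesis using obtain_subset_with_card_n[of 3 "L v"] L that unfolding V_def by metis
  next
    case False
    then show ?thesis using infinite_arbitrarily_large by blast
  qed
  then obtain A where A: "\<And>v. v \<in> V \<Longrightarrow> A v \<subseteq> L v" "\<And>v. v \<in> V \<Longrightarrow> finite (A v)" "\<And>v. v \<in> V \<Longrightarrow> card (A v) = 3"
    by metis
  have le_Max: "f v \<le> Max (insert 0 (f ` V))" if "v \<in> V" for f :: "'a \<Rightarrow> nat" and v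
    using fin that by (intro Max_ge) auto
  have "\<exists>c. majority_on E V c \<and> (\<forall>v\<in>V. c v \<in> A v)"
  proof (cases "max_degree_underlying D \<le> 6")
    case True
    have deg: "card (neighbors_in E V v) \<le> 6" if "v \<in> V" for v
      using le_Max[OF that, of "out_degree (with_proj (mk_symmetric D))"] True
      unfolding max_degree_underlying_def max_out_degree_def
      by (simp add: underlying_degree_eq_card V_def[symmetric] E_def[symmetric])
    show ?thesis
      by (rule majority_of_underlying_degree_le_6[OF fin irrefl]) (use A(2,3) deg in blast)+
  next
    case False
    then have "max_out_degree D \<le> 4 \<or> max_degree D \<le> 7" using assms(2) by blast
    then have deg: "card {w \<in> V. (v, w) \<in> E} \<le> 4" if "v \<in> V" "3 \<le> card {w \<in> V. (w, v) \<in> E}" for v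
      using le_Max[OF that(1), of "out_degree D"] le_Max[OF that(1), of "\<lambda>v. out_degree D v + in_degree D v"] that(2)
      unfolding max_degree_def max_out_degree_def V_def[symmetric]
      unfolding out_degree_eq_card in_degree_eq_card V_def[symmetric] E_def[symmetric]
      by linarith
    show ?thesis
      by (rule majority_of_out_degree_le_4[OF fin irrefl]) (use A(2,3) deg in blast)+
  qed
  then obtain c where c: "majority_on E V c" "\<forall>v\<in>V. c v \<in> A v" by blast
  have "out_neighbors D v = {w \<in> V. (v, w) \<in> E}" for v
    by (auto simp: out_neighbors_def V_def E_def)
  then have "{w \<in> out_neighbors D v. c w = c v} = {w \<in> V. (v, w) \<in> E \<and> c w = c v}"
    "out_neighbors D v = {w \<in> V. (v, w) \<in> E}" for v by auto
  then have "majority_coloring D c"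
    using c(1) unfolding majority_coloring_def majority_on_def V_def by simp
  moreover have "\<forall>v\<in>verts D. c v \<in> L v" using c(2) A(1) unfolding V_def by blast
  ultimately show "\<exists>c. majority_coloring D c \<and> (\<forall>v\<in>verts D. c v \<in> L v)" by blast
qed

end
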